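(* Let $n\ge 4$ be an even integer. There exists $\lambda_1>\sqrt{2}$ such that $Z_{\lambda_1}h_n(\tfrac14,\tfrac12)=0$ and $$\left(\tfrac{\lambda_1}{2},\tfrac{1}{\lambda_1}\right)\notin\mathscr{F}(h_n),\qquad \left(\tfrac{1}{\lambda_1},\tfrac{\lambda_1}{2}\right)\notin\mathscr{F}(h_n).$$
   Context: For $n\in\mathbb{Z}_{\ge 0}$ the Hermite function is $h_n(x) = (-1)^n c_n^{-1/2} e^{\pi x^2}\frac{d^n}{dx^n}e^{-2\pi x^2}$, $x\in\mathbb{R}$, with $c_n=(2\pi)^n 2^{n-1/2} n!$. For $\lambda>0$ the Zak transform is $Z_\lambda f(x,\gamma)=\sqrt{\lambda}\sum_{k\in\mathbb{Z}}f(\lambda(x+k))e^{-2\pi i k\gamma}$, $x,\gamma\in\mathbb{R}$. For $g\in L^2(\mathbb{R})$ and $\alpha,\beta>0$, the Gabor system is $\mathcal{G}(g,\alpha,\beta)=\{e^{2\pi i\beta m\cdot}g(\cdot-\alpha k)\}_{k,m\in\mathbb{Z}}$. It is a frame for $L^2(\mathbb{R})$ if there are constants $A,B>0$ with $A\|f\|^2\le\sum_{k,m\in\mathbb{Z}}|\langle f,e^{2\pi i\beta m\cdot}g(\cdot-\alpha k)\rangle|^2\le B\|f\|^2$ for all $f\in L^2(\mathbb{R})$. The frame set $\mathscr{F}(g)$ is the set of $(\alpha,\beta)\in\mathbb{R}_{>0}^2$ for which $\mathcal{G}(g,\alpha,\beta)$ is a frame for $L^2(\mathbb{R})$. *)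

theory Defs
  imports "HOL-Analysis.Analysis"
begin

definition hermite_const :: "nat \<Rightarrow> real" where
  "hermite_const n = (2 * pi) ^ n * 2 powr (real n - 1 / 2) * fact n"

definition hermite_fun :: "nat \<Rightarrow> real \<Rightarrow> complex" where
  "hermite_fun n x = complex_of_real
     ((-1) ^ n * hermite_const n powr (- 1 / 2) * exp (pi * x\<^sup>2) *
      (deriv ^^ n) (\<lambda>y::real. exp (- 2 * pi * y\<^sup>2)) x)"

text \<open>The series is an unconditional sum over the integers; it converges absolutely for
  the rapidly decreasing Hermite functions, so the default value of \<open>infsum\<close> for
  non-summable families is never attained there.\<close>

definition zak :: "real \<Rightarrow> (real \<Rightarrow> complex) \<Rightarrow> real \<Rightarrow> real \<Rightarrow> complex" where
  "zak l f x \<gamma> = complex_of_real (sqrt l) *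
     (\<Sum>\<^sub>\<infinity>k\<in>(UNIV :: int set).
        f (l * (x + of_int k)) * exp (- 2 * complex_of_real pi * \<i> * of_int k * complex_of_real \<gamma>))"

text \<open>Elements of \<open>L\<^sup>2(\<real>)\<close> are represented by square-integrable Borel functions rather than
  by classes modulo null sets; every class has a Borel representative, and the inner product
  and the norm do not depend on it.\<close>

definition L2 :: "(real \<Rightarrow> complex) set" where
  "L2 = {f. f \<in> borel_measurable lborel \<and> integrable lborel (\<lambda>x. (norm (f x))\<^sup>2)}"

definition L2_inner :: "(real \<Rightarrow> complex) \<Rightarrow> (real \<Rightarrow> complex) \<Rightarrow> complex" where
  "L2_inner f g = (LINT x|lborel. f x * cnj (g x))"

definition L2_norm :: "(real \<Rightarrow> complex) \<Rightarrow> real" where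
  "L2_norm f = sqrt (LINT x|lborel. (norm (f x))\<^sup>2)"

definition is_L2_frame :: "('i \<Rightarrow> real \<Rightarrow> complex) \<Rightarrow> bool" where
  "is_L2_frame \<phi> \<longleftrightarrow> (\<exists>A>0. \<exists>B>0. \<forall>f\<in>L2.
     (\<lambda>i. (norm (L2_inner f (\<phi> i)))\<^sup>2) summable_on UNIV \<and>
     A * (L2_norm f)\<^sup>2 \<le> (\<Sum>\<^sub>\<infinity>i. (norm (L2_inner f (\<phi> i)))\<^sup>2) \<and>
     (\<Sum>\<^sub>\<infinity>i. (norm (L2_inner f (\<phi> i)))\<^sup>2) \<le> B * (L2_norm f)\<^sup>2)"

definition gabor_system ::
  "(real \<Rightarrow> complex) \<Rightarrow> real \<Rightarrow> real \<Rightarrow> int \<times> int \<Rightarrow> real \<Rightarrow> complex" where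
  "gabor_system g \<alpha> \<beta> = (\<lambda>(k, m) x.
     exp (2 * complex_of_real pi * \<i> * complex_of_real \<beta> * of_int m * complex_of_real x) *
     g (x - \<alpha> * of_int k))"

definition frame_set :: "(real \<Rightarrow> complex) \<Rightarrow> (real \<times> real) set" where
  "frame_set g = {(\<alpha>, \<beta>). 0 < \<alpha> \<and> 0 < \<beta> \<and> is_L2_frame (gabor_system g \<alpha> \<beta>)}"

end

theory Submission
  imports Defs "HOL-Probability.Characteristic_Functions" "HOL-Library.Nat_Bijection"
begin

text \<open>
For a window \<open>g\<close>, \<open>\<alpha> = l / 2\<close> and \<open>\<beta> = 1 / l\<close>, the Zak transform turns the frame operator into
multiplication by \<open>\<bar>Z g (x, \<gamma>)\<bar>\<^sup>2 + \<bar>Z g (x - 1/2, \<gamma>)\<bar>\<^sup>2\<close>, so a common zero of the two summands destroys the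
lower frame bound. At \<open>\<gamma> = 1/2\<close> this can be seen directly: a finite alternating
comb of short intervals is an explicit function whose inner products with the Gabor system are too small, by
Bessel's inequality alone (\<open>not_frame_of_altsum_zero\<close>). For an even function the
points \<open>x = 1/4\<close> and \<open>x = -1/4\<close> are equivalent, hence a single zero of \<open>Z\<close> at
\<open>(1/4, 1/2)\<close> suffices.

For even \<open>n\<close> the value of \<open>Z\<close> there is, up to a positive factor, the series \<open>theta n l\<close>. It has a zero beyond
\<open>\<surd>2\<close> by the intermediate value theorem (\<open>ex_theta_zero\<close>). It is positive for large \<open>l\<close>,
because the first term dominates. It is negative at \<open>l = 4 x\<close>, where \<open>x\<close> is the largest zero of the Hermite
function: the first term vanishes and the others, values of a decreasing positive
function at \<open>3 x, 5 x, 7 x, ...\<close>, carry the signs \<open>- - + +\<close>. The bound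
\<open>4 \<pi> x\<^sup>2 \<ge> n - 1\<close> for the largest zero guarantees both the monotonicity from \<open>3 x\<close> on and \<open>4 x > \<surd>2\<close>.

The second pair \<open>(1 / l, l / 2)\<close> is the first one with \<open>2 / l\<close> in place of \<open>l\<close>. So it remains to see
that the zeros of \<open>theta n\<close> are invariant under \<open>l \<mapsto> 2 / l\<close>. This is a functional
equation (\<open>theta_functional\<close>), the trace of the Fourier invariance of Hermite functions. For \<open>n = 0\<close> it is
Poisson summation for a Gaussian (\<open>theta0_functional\<close>). It passes from \<open>n\<close> to \<open>n + 2\<close> because
\<open>l d/dl + 1/2\<close> changes sign under the reflection and maps \<open>theta n\<close> to a combination of \<open>theta (n - 2)\<close> and
\<open>theta (n + 2)\<close> (\<open>theta_functional_step\<close>).\<close>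

section \<open>Hermite functions\<close>

text \<open>Up to the positive constant \<open>hermite_const n powr (- 1 / 2)\<close>, the Hermite function is the
Gaussian times a polynomial with positive leading coefficient. The three-term recurrence is
taken as the definition because every fact about zeros below is read off from it.\<close>

fun herm :: "nat \<Rightarrow> real \<Rightarrow> real" where
  "herm 0 x = 1"
| "herm (Suc 0) x = 4 * pi * x"
| "herm (Suc (Suc n)) x = 4 * pi * x * herm (Suc n) x - 4 * pi * real (Suc n) * herm n x"

definition psi :: "nat \<Rightarrow> real \<Rightarrow> real" where
  "psi n x = herm n x * exp (- pi * x\<^sup>2)"

lemma herm_Suc: "herm (Suc n) x = 4 * pi * x * herm n x - 4 * pi * real n * herm (n - 1) x"
  by (cases n) auto

lemma DERIV_herm: "(herm n has_real_derivative 4 * pi * real n * herm (n - 1) x) (at x)"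
proof (induction n arbitrary: x rule: induct_nat_012)
  case 0
  have "herm 0 = (\<lambda>x. 1)" by auto
  then show ?case by simp
next
  case 1
  have "herm (Suc 0) = (\<lambda>x. 4 * pi * x)" by auto
  then show ?case by (auto intro!: derivative_eq_intros)
next
  case (ge2 n)
  have eq: "herm (Suc (Suc n)) = (\<lambda>x. 4 * pi * x * herm (Suc n) x - 4 * pi * real (Suc n) * herm n x)"
    by auto
  have "((\<lambda>x. 4 * pi * x * herm (Suc n) x - 4 * pi * real (Suc n) * herm n x) has_real_derivative
     4 * pi * herm (Suc n) x + 4 * pi * x * (4 * pi * real (Suc n) * herm n x) 
      - 4 * pi * real (Suc n) * (4 * pi * real n * herm (n - 1) x)) (at x)"
    using ge2.IH(2)[of x]
    by (auto intro!: derivative_eq_intros ge2.IH simp del: of_nat_Suc herm.simps)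
  also have "4 * pi * herm (Suc n) x + 4 * pi * x * (4 * pi * real (Suc n) * herm n x) 
      - 4 * pi * real (Suc n) * (4 * pi * real n * herm (n - 1) x) = 
     4 * pi * herm (Suc n) x + 4 * pi * real (Suc n) * herm (Suc n) x"
    unfolding herm_Suc[of n] by algebra
  also have "\<dots> = 4 * pi * real (Suc (Suc n)) * herm (Suc (Suc n) - 1) x"
    by (simp add: algebra_simps)
  finally show ?case unfolding eq .
qed

lemma deriv_gauss_iter:
  "(deriv ^^ n) (\<lambda>y::real. exp (- 2 * pi * y\<^sup>2)) = (\<lambda>x. (- 1) ^ n * herm n x * exp (- 2 * pi * x\<^sup>2))"
proof (induction n)
  case 0
  then show ?case by simp
next
  case (Suc n)
  have "deriv (\<lambda>x. (- 1) ^ n * herm n x * exp (- 2 * pi * x\<^sup>2)) x =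
      (- 1) ^ Suc n * herm (Suc n) x * exp (- 2 * pi * x\<^sup>2)" for x
    by (rule DERIV_imp_deriv)
       (auto intro!: derivative_eq_intros DERIV_herm simp: herm_Suc algebra_simps)
  then have "deriv (\<lambda>x. (- 1) ^ n * herm n x * exp (- 2 * pi * x\<^sup>2)) =
      (\<lambda>x. (- 1) ^ Suc n * herm (Suc n) x * exp (- 2 * pi * x\<^sup>2))" ..
  then show ?case by (simp only: funpow.simps o_apply Suc.IH)
qed

lemma hermite_fun_eq_psi:
  "hermite_fun n x = complex_of_real (hermite_const n powr (- 1 / 2) * psi n x)"
proof -
  have *: "exp (pi * x\<^sup>2) * exp (- 2 * pi * x\<^sup>2) = exp (- pi * x\<^sup>2)"
    by (simp flip: exp_add)
  have **: "(- 1 :: real) ^ n * (- 1) ^ n = 1"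
    by (simp flip: power_mult_distrib)
  have "(- 1) ^ n * c * exp (pi * x\<^sup>2) * ((- 1) ^ n * herm n x * exp (- 2 * pi * x\<^sup>2))
      = c * (herm n x * exp (- pi * x\<^sup>2))" for c
  proof -
    have "(- 1) ^ n * c * exp (pi * x\<^sup>2) * ((- 1) ^ n * herm n x * exp (- 2 * pi * x\<^sup>2))
      = ((- 1) ^ n * (- 1) ^ n) * (c * (herm n x * (exp (pi * x\<^sup>2) * exp (- 2 * pi * x\<^sup>2))))"
      by (simp only: mult.assoc mult.commute mult.left_commute)
    then show ?thesis
      using *[symmetric] ** by simp
  qed
  then show ?thesis
    unfolding hermite_fun_def deriv_gauss_iter psi_def by (simp only:)
qed

lemma hermite_const_pos: "hermite_const n > 0"
  by (simp add: hermite_const_def)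

lemma herm_minus: "herm n (- x) = (- 1) ^ n * herm n x"
  by (induction n x rule: herm.induct) (auto simp: algebra_simps)

lemma psi_even: "even n \<Longrightarrow> psi n (- x) = psi n x"
  by (simp add: psi_def herm_minus)

lemma DERIV_psi:
  "(psi n has_real_derivative 2 * pi * real n * psi (n - 1) x - psi (Suc n) x / 2) (at x)"
proof -
  have eq: "psi n = (\<lambda>x. herm n x * exp (- pi * x\<^sup>2))" by (auto simp: psi_def)
  show ?thesis unfolding eq
    by (rule derivative_eq_intros DERIV_herm refl)+ (simp add: psi_def herm_Suc field_simps)
qed

lemma continuous_on_psi [continuous_intros]: 
  "continuous_on A f \<Longrightarrow> continuous_on A (\<lambda>x. psi n (f x))"
  by (rule continuous_on_compose2[of UNIV "psi n"])
     (auto intro!: continuous_at_imp_continuous_on DERIV_isCont DERIV_psi)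

lemma mult_psi: "x * psi n x = psi (Suc n) x / (4 * pi) + real n * psi (n - 1) x"
  by (simp add: psi_def herm_Suc field_simps)

text \<open>The Euler operator \<open>x d/dx\<close> moves the index only by two steps, and, up to the shift by one half,
it has no diagonal part. Applied to a function of \<open>l \<kappa>\<close> it is the same as \<open>l d/dl\<close>, so dilating a
sum of values of \<open>psi n\<close> and differentiating stays inside this family.\<close>

lemma mult_deriv_psi:
  "x * (2 * pi * real n * psi (n - 1) x - psi (Suc n) x / 2) =
     2 * pi * real (n * (n - 1)) * psi (n - 2) x - psi n x / 2 - psi (n + 2) x / (8 * pi)"
proof -
  have "x * (2 * pi * real n * psi (n - 1) x - psi (Suc n) x / 2) =
     2 * pi * real n * (x * psi (n - 1) x) - (x * psi (Suc n) x) / 2" by algebra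
  also have "\<dots> = 2 * pi * real n * (psi (Suc (n - 1)) x / (4 * pi) + real (n - 1) * psi (n - 2) x)
      - (psi (Suc (Suc n)) x / (4 * pi) + real (Suc n) * psi n x) / 2"
    unfolding mult_psi by (simp add: numeral_2_eq_2)
  also have "\<dots> = 2 * pi * real (n * (n - 1)) * psi (n - 2) x - psi n x / 2 - psi (n + 2) x / (8 * pi)"
    by (cases n) (auto simp: field_simps)
  finally show ?thesis .
qed

text \<open>The rate \<open>a\<close> is arbitrary so that the induction can spend half of it on the factor \<open>x\<close> in the
recurrence.\<close>

lemma herm_bound: "0 < a \<Longrightarrow> \<exists>C. \<forall>x. \<bar>herm n x\<bar> \<le> C * exp (a * \<bar>x\<bar>)"
proof (induction n arbitrary: a rule: less_induct)
  case (less n)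
  show ?case
  proof (cases n)
    case 0
    then show ?thesis using less.prems by (intro exI[of _ 1]) simp
  next
    case (Suc m)
    obtain C where C: "\<bar>herm m x\<bar> \<le> C * exp (a / 2 * \<bar>x\<bar>)" for x
      using less.IH[of m "a / 2"] less.prems Suc by auto
    obtain E where E: "\<bar>herm (m - 1) x\<bar> \<le> E * exp (a * \<bar>x\<bar>)" for x
      using less.IH[of "m - 1" a] less.prems Suc by (metis diff_less_Suc)
    have x: "\<bar>x\<bar> \<le> 2 / a * exp (a / 2 * \<bar>x\<bar>)" for x
    proof -
      have "a / 2 * \<bar>x\<bar> \<le> exp (a / 2 * \<bar>x\<bar>)"
        using exp_ge_add_one_self[of "a / 2 * \<bar>x\<bar>"] by linarith
      then show ?thesis using less.prems by (simp add: field_simps)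
    qed
    have "\<bar>herm n x\<bar> \<le> (4 * pi * (2 / a * C) + 4 * pi * real m * E) * exp (a * \<bar>x\<bar>)" for x
    proof -
      have "\<bar>x\<bar> * \<bar>herm m x\<bar> \<le> (2 / a * exp (a / 2 * \<bar>x\<bar>)) * (C * exp (a / 2 * \<bar>x\<bar>))"
        by (rule mult_mono[OF x C]) (use less.prems in auto)
      also have "\<dots> = 2 / a * C * exp (a * \<bar>x\<bar>)"
        by (simp flip: exp_add add: field_simps)
      finally have 1: "4 * pi * (\<bar>x\<bar> * \<bar>herm m x\<bar>) \<le> 4 * pi * (2 / a * C * exp (a * \<bar>x\<bar>))"
        by (rule mult_left_mono) simp
      have 2: "4 * pi * real m * \<bar>herm (m - 1) x\<bar> \<le> 4 * pi * real m * (E * exp (a * \<bar>x\<bar>))"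
        by (intro mult_left_mono E) auto
      have "\<bar>herm n x\<bar> \<le> 4 * pi * (\<bar>x\<bar> * \<bar>herm m x\<bar>) + 4 * pi * real m * \<bar>herm (m - 1) x\<bar>"
        unfolding Suc herm_Suc[of m] by (rule order_trans[OF abs_triangle_ineq4]) (simp add: abs_mult)
      also have "\<dots> \<le> 4 * pi * (2 / a * C * exp (a * \<bar>x\<bar>)) + 4 * pi * real m * (E * exp (a * \<bar>x\<bar>))"
        by (intro add_mono 1 2)
      finally show ?thesis by (simp add: algebra_simps)
    qed
    then show ?thesis by blast
  qed
qed

lemma psi_bound: obtains C where "C > 0" "\<And>x. \<bar>psi n x\<bar> \<le> C * exp (- \<bar>x\<bar>)"
proof -
  obtain C where C: "\<bar>herm n x\<bar> \<le> C * exp (1 * \<bar>x\<bar>)" for x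
    using herm_bound[of 1 n] by auto
  have C0: "C \<ge> 0" using C[of 0] abs_ge_zero[of "herm n 0"] by simp
  have "\<bar>psi n x\<bar> \<le> (C * exp 1 + 1) * exp (- \<bar>x\<bar>)" for x
  proof -
    have "2 * \<bar>x\<bar> \<le> 1 + \<bar>x\<bar>^2"
      using zero_le_power2[of "\<bar>x\<bar> - 1"] by (simp add: power2_eq_square algebra_simps)
    also have "\<dots> \<le> 1 + pi * x^2" using pi_gt3 by (simp add: mult_le_cancel_right1)
    finally have le: "\<bar>x\<bar> - pi * x^2 \<le> 1 - \<bar>x\<bar>" by simp
    have "\<bar>psi n x\<bar> \<le> C * exp (1 * \<bar>x\<bar>) * exp (- pi * x\<^sup>2)"
      unfolding psi_def abs_mult by (intro mult_mono C) (auto simp: C0)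
    also have "\<dots> = C * exp (\<bar>x\<bar> - pi * x\<^sup>2)"
      by (simp add: exp_diff exp_minus field_simps)
    also have "\<dots> \<le> C * exp (1 - \<bar>x\<bar>)"
      using le C0 by (intro mult_left_mono) auto
    also have "\<dots> = C * exp 1 * exp (- \<bar>x\<bar>)" by (simp flip: exp_add)
    also have "\<dots> \<le> (C * exp 1 + 1) * exp (- \<bar>x\<bar>)" by (intro mult_right_mono) auto
    finally show ?thesis .
  qed
  moreover have "C * exp 1 + 1 > 0" using C0 by (simp add: add_nonneg_pos)
  ultimately show ?thesis using that by blast
qed


section \<open>Sign and monotonicity beyond the largest zero\<close>

text \<open>In terms of the ratio \<open>q k = herm (Suc k) x / herm k x\<close> the recurrence is
\<open>q (k + 1) = 4 \<pi> x - 4 \<pi> (k + 1) / q k\<close>; the bound \<open>q k \<ge> 2 \<pi> x\<close> is reproduced by it exactly when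
\<open>\<pi> x\<^sup>2 \<ge> k + 1\<close>. The ratio bound is also what makes \<open>psi n\<close> decrease there, since
the derivative of \<open>psi n\<close> is a combination of \<open>herm (n - 1)\<close> and \<open>herm n\<close>.\<close>

lemma herm_pos_large:
  assumes "x > 0" "real n \<le> pi * x\<^sup>2" "k \<le> n"
  shows "herm k x > 0 \<and> herm (Suc k) x \<ge> 2 * pi * x * herm k x"
  using assms(3)
proof (induction k)
  case 0
  then show ?case using assms by simp
next
  case (Suc k)
  then have IH: "herm k x > 0" "herm (Suc k) x \<ge> 2 * pi * x * herm k x" by auto
  have pos: "herm (Suc k) x > 0" 
    using IH assms(1) by (smt (verit) mult_pos_pos pi_gt_zero)
  have k: "real (Suc k) \<le> pi * x\<^sup>2" using Suc.prems assms(2) by linarith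
  have "4 * pi * real (Suc k) * herm k x * x \<le> 2 * real (Suc k) * herm (Suc k) x"
    using mult_left_mono[OF IH(2), of "2 * real (Suc k)"] by (simp add: algebra_simps)
  also have "\<dots> \<le> 2 * (pi * x\<^sup>2) * herm (Suc k) x"
    using k pos by (intro mult_right_mono mult_left_mono) auto
  also have "\<dots> = (2 * pi * x * herm (Suc k) x) * x" by (simp add: power2_eq_square)
  finally have "4 * pi * real (Suc k) * herm k x \<le> 2 * pi * x * herm (Suc k) x"
    using assms(1) by (simp del: of_nat_Suc)
  then show ?case using pos by (simp del: of_nat_Suc)
qed

lemma deriv_psi_le:
  assumes "x > 0" "real n \<le> pi * x\<^sup>2"
  shows "2 * pi * real n * psi (n - 1) x - psi (Suc n) x / 2 \<le> (2 * real n / x - 2 * pi * x) * psi n x"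
proof (cases n)
  case 0
  then show ?thesis by (simp add: psi_def)
next
  case (Suc m)
  have "2 * pi * x * herm m x \<le> herm n x" 
    using herm_pos_large[of x n m] assms Suc by simp
  then have "4 * pi * real n * herm m x * x \<le> 2 * real n * herm n x"
    using mult_left_mono[of "2 * pi * x * herm m x" "herm n x" "2 * real n"] by (simp add: algebra_simps)
  then have *: "4 * pi * real n * herm m x \<le> 2 * real n / x * herm n x"
    using assms(1) by (simp add: field_simps)
  have "2 * pi * real n * psi (n - 1) x - psi (Suc n) x / 2 =
        (4 * pi * real n * herm m x - 2 * pi * x * herm n x) * exp (- pi * x\<^sup>2)"
    unfolding psi_def herm_Suc[of n] using Suc by (simp add: field_simps)
  also have "\<dots> \<le> (2 * real n / x * herm n x - 2 * pi * x * herm n x) * exp (- pi * x\<^sup>2)"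
    using * by (intro mult_right_mono) auto
  also have "\<dots> = (2 * real n / x - 2 * pi * x) * psi n x"
    by (simp add: psi_def algebra_simps)
  finally show ?thesis .
qed

lemma psi_pos_large: "x > 0 \<Longrightarrow> real n \<le> pi * x\<^sup>2 \<Longrightarrow> psi n x > 0"
  using herm_pos_large[of x n n] by (simp add: psi_def)

lemma psi_strict_decreasing:
  assumes "0 < x" "real n < pi * x\<^sup>2" "x < y"
  shows "psi n y < psi n x"
proof (rule DERIV_neg_imp_decreasing[OF assms(3)], intro exI conjI)
  fix t assume t: "x \<le> t" "t \<le> y"
  show "DERIV (psi n) t :> 2 * pi * real n * psi (n - 1) t - psi (Suc n) t / 2"
    by (rule DERIV_psi)
  have t0: "t > 0" using t assms by simp
  have "pi * x\<^sup>2 \<le> pi * t\<^sup>2" using t assms by (intro mult_left_mono power_mono) auto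
  then have n: "real n < pi * t\<^sup>2" using assms(2) by linarith
  have "2 * real n / t - 2 * pi * t < 0"
    using n t0 by (simp add: field_simps power2_eq_square)
  then have "(2 * real n / t - 2 * pi * t) * psi n t < 0"
    using psi_pos_large[of t n] t0 n by (simp add: mult_neg_pos)
  then show "2 * pi * real n * psi (n - 1) t - psi (Suc n) t / 2 < 0"
    using deriv_psi_le[of t n] t0 n by simp
qed

lemma pi_square_ge:
  assumes "real n + 1 \<le> x"
  shows "real n \<le> pi * x\<^sup>2"
proof -
  have "real n \<le> x * 1" using assms by simp
  also have "\<dots> \<le> x * (pi * x)"
    using assms pi_gt3 mult_mono[of 1 pi 1 x] by (intro mult_left_mono) auto
  finally show ?thesis by (simp add: power2_eq_square mult_ac)
qed

lemma psi_exponential_decay: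
  assumes "real n + 1 \<le> x" "x \<le> y"
  shows "psi n y \<le> exp (x - y) * psi n x"
proof -
  have "exp y * psi n y \<le> exp x * psi n x"
  proof (rule DERIV_nonpos_imp_nonincreasing[OF assms(2)], intro exI conjI)
    fix t assume t: "x \<le> t" "t \<le> y"
    show "DERIV (\<lambda>t. exp t * psi n t) t :> 
       exp t * psi n t + exp t * (2 * pi * real n * psi (n - 1) t - psi (Suc n) t / 2)"
      by (auto intro!: derivative_eq_intros DERIV_psi)
    have t1: "t \<ge> real n + 1" using t assms by simp
    then have t0: "t > 0" by simp
    have n: "real n \<le> pi * t\<^sup>2" by (rule pi_square_ge[OF t1])
    have "2 * real n / t \<le> 2" using t1 by (simp add: field_simps)
    moreover have "2 * pi * t \<ge> 2 * 3 * 1" using t1 pi_gt3 by (intro mult_mono) auto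
    ultimately have "2 * real n / t - 2 * pi * t \<le> - 1" by simp
    then have "(2 * real n / t - 2 * pi * t) * psi n t \<le> - 1 * psi n t"
      using psi_pos_large[of t n] t0 n by (intro mult_right_mono) auto
    then have "psi n t + (2 * pi * real n * psi (n - 1) t - psi (Suc n) t / 2) \<le> 0"
      using deriv_psi_le[of t n] t0 n by simp
    then have "exp t * (psi n t + (2 * pi * real n * psi (n - 1) t - psi (Suc n) t / 2)) \<le> 0"
      by (simp add: mult_le_0_iff)
    then show "exp t * psi n t + exp t * (2 * pi * real n * psi (n - 1) t - psi (Suc n) t / 2) \<le> 0"
      by (simp only: distrib_left)
  qed
  then show ?thesis by (simp add: exp_diff field_simps)
qed

lemma continuous_on_herm: "continuous_on A (herm n)"
  by (auto intro!: continuous_at_imp_continuous_on DERIV_isCont DERIV_herm)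

text \<open>The positivity of all lower polynomials from \<open>x\<close> on is recorded as well: it expresses that the
largest zeros increase with the degree, and it carries the induction that produces them.\<close>

definition last_zero :: "nat \<Rightarrow> real \<Rightarrow> bool" where
  "last_zero n x \<longleftrightarrow> x \<ge> 0 \<and> herm n x = 0 \<and> (\<forall>y>x. herm n y > 0) \<and> (\<forall>k<n. \<forall>y\<ge>x. herm k y > 0)"

text \<open>At the largest zero \<open>x\<close> of \<open>herm n\<close> the recurrence gives
\<open>herm (n + 1) x = - 4 \<pi> n herm (n - 1) x < 0\<close>, while \<open>herm (n + 1)\<close> is positive far out. Hence its
largest zero lies strictly to the right of \<open>x\<close>.\<close>

lemma ex_last_zero: "n \<ge> 1 \<Longrightarrow> \<exists>x. last_zero n x"
proof (induction n rule: nat_induct_at_least)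
  case base
  show ?case by (rule exI[of _ 0]) (auto simp: last_zero_def)
next
  case (Suc n)
  then obtain x where x: "x \<ge> 0" "herm n x = 0" "\<And>y. y > x \<Longrightarrow> herm n y > 0" 
      "\<And>k y. k < n \<Longrightarrow> y \<ge> x \<Longrightarrow> herm k y > 0" by (auto simp: last_zero_def)
  have neg: "herm (Suc n) x < 0"
    using x(2) x(4)[of "n - 1" x] \<open>n \<ge> 1\<close> by (simp add: herm_Suc)
  define S where "S = {y. x \<le> y \<and> herm (Suc n) y \<le> 0}"
  have S_ub: "y \<le> real n + 1" if "y \<in> S" for y
  proof (rule ccontr)
    assume "\<not> y \<le> real n + 1"
    then have y: "y > real n + 1" by simp
    have "real (Suc n) \<le> 1 * y" using y by simp
    also have "\<dots> \<le> (pi * y) * y" 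
      using y pi_gt3 mult_mono[of 1 pi 1 y] by (intro mult_right_mono) auto
    finally have "herm (Suc n) y > 0"
      using herm_pos_large[of y "Suc n" "Suc n"] y by (simp add: power2_eq_square algebra_simps)
    then show False using that by (simp add: S_def)
  qed
  have S: "bdd_above S" "S \<noteq> {}" "closed S"
    using S_ub neg 
    by (auto simp: S_def bdd_above_def less_imp_le intro!: closed_Collect_conj closed_Collect_le continuous_intros continuous_on_herm)
  define z where "z = Sup S"
  have "z \<in> S" unfolding z_def using S by (rule_tac closed_contains_Sup) auto
  have above: "herm (Suc n) y > 0" if "y > z" for y
  proof (rule ccontr)
    assume "\<not> herm (Suc n) y > 0"
    moreover have "y > x" using that \<open>z \<in> S\<close> by (simp add: S_def)
    ultimately have "y \<in> S" by (simp add: S_def)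
    then have "y \<le> z" unfolding z_def using S by (intro cSup_upper) auto
    then show False using that by simp
  qed
  have zero: "herm (Suc n) z = 0"
  proof (rule antisym)
    show "herm (Suc n) z \<le> 0" using \<open>z \<in> S\<close> by (simp add: S_def)
    have "((herm (Suc n)) \<longlongrightarrow> herm (Suc n) z) (at_right z)"
      using continuous_on_herm[of UNIV "Suc n"] 
      by (auto simp: continuous_on_def intro: tendsto_within_subset)
    moreover have "eventually (\<lambda>y. herm (Suc n) y \<ge> 0) (at_right z)"
      using above by (auto simp: eventually_at_right_less intro!: eventually_at_rightI[of z "z + 1"] less_imp_le)
    ultimately show "0 \<le> herm (Suc n) z"
      by (intro tendsto_lowerbound[where f = "herm (Suc n)"]) auto
  qed
  have zx: "z > x" using \<open>z \<in> S\<close> zero neg unfolding S_def by (cases "z = x") auto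
  have "herm k y > 0" if "k < Suc n" "y \<ge> z" for k y
    using that x(3)[of y] x(4)[of k y] zx by (cases "k = n") auto
  then show ?case using zx x(1) zero above by (intro exI[of _ z]) (auto simp: last_zero_def)
qed

text \<open>Two steps of the recurrence at the zero, discarding one positive term. It amounts to bounding
the largest eigenvalue of a Jacobi matrix from below by that of its last \<open>2 \<times> 2\<close> block.\<close>

lemma last_zero_lower_bound:
  assumes "last_zero n x" "n \<ge> 3"
  shows "real n - 1 \<le> 4 * pi * x\<^sup>2"
proof -
  define m where "m = n - 3"
  have n: "n = Suc (Suc (Suc m))" using assms(2) by (simp add: m_def)
  have p: "herm (Suc (Suc m)) x > 0" "herm m x > 0" "x \<ge> 0" "herm n x = 0"
    using assms(1) n by (auto simp: last_zero_def simp del: herm.simps)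
  have 1: "x * herm (Suc (Suc m)) x = real (Suc (Suc m)) * herm (Suc m) x"
    using p(4) unfolding n herm.simps(3)[of "Suc m"] by (simp del: of_nat_Suc herm.simps(3))
  have 2: "herm (Suc (Suc m)) x \<le> 4 * pi * x * herm (Suc m) x"
    using p(2) by simp
  have "real (Suc (Suc m)) * herm (Suc (Suc m)) x \<le> real (Suc (Suc m)) * (4 * pi * x * herm (Suc m) x)"
    by (rule mult_left_mono[OF 2]) simp
  also have "\<dots> = 4 * pi * x * (x * herm (Suc (Suc m)) x)" unfolding 1 by simp
  also have "\<dots> = (4 * pi * x\<^sup>2) * herm (Suc (Suc m)) x" by (simp add: power2_eq_square)
  finally have "real (Suc (Suc m)) \<le> 4 * pi * x\<^sup>2"
    using p(1) by (simp del: of_nat_Suc herm.simps)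
  then show ?thesis by (simp add: n)
qed

section \<open>The theta series of a Hermite function\<close>

text \<open>The signs \<open>+ - - +\<close>, repeated: \<open>chi m\<close> is the value at \<open>2 m + 1\<close> of the even real
Dirichlet character modulo 8. The same signs arise in two ways, from \<open>(-1)\<^sup>k\<close> at the points
\<open>4 k + 1\<close> sorted by absolute value, and from the values of \<open>\<surd>2 cos\<close> at
\<open>(2 m + 1) \<pi> / 4\<close>; this coincidence is the reason for the functional equation.\<close>

definition chi :: "nat \<Rightarrow> real" where
  "chi m = (- 1) ^ (Suc m div 2)"

text \<open>For even \<open>n\<close> this is the alternating sum of \<open>psi n (l (k + 1/4))\<close> over the integers \<open>k\<close>, folded
onto the naturals by parity (proved as \<open>theta_has_sum\<close>).\<close>

definition theta :: "nat \<Rightarrow> real \<Rightarrow> real" where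
  "theta n l = (\<Sum>m. chi m * psi n (l * (2 * real m + 1) / 4))"

lemma abs_chi [simp]: "\<bar>chi m\<bar> = 1"
  by (simp add: chi_def power_abs)

lemma psi_term_bound:
  assumes "0 < a" "a \<le> l" "\<And>x. \<bar>psi n x\<bar> \<le> C * exp (- \<bar>x\<bar>)" "C > 0"
  shows "\<bar>chi m * psi n (l * (2 * real m + 1) / 4)\<bar> \<le> C * exp (- a / 2) ^ m"
proof -
  have "\<bar>chi m * psi n (l * (2 * real m + 1) / 4)\<bar> \<le> C * exp (- \<bar>l * (2 * real m + 1) / 4\<bar>)"
    using assms(3)[of "l * (2 * real m + 1) / 4"] by (simp only: abs_mult abs_chi mult_1)
  also have "\<dots> \<le> C * exp (real m * (- a / 2))"
  proof -
    have "a * real m \<le> l * real m" using assms by (intro mult_right_mono) auto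
    then have "a * (2 * real m) \<le> l * (2 * real m + 1)"
      using assms by (simp add: algebra_simps)
    then show ?thesis using assms by simp
  qed
  finally show ?thesis by (simp only: exp_of_nat_mult)
qed

lemma summable_exp_power: "0 < a \<Longrightarrow> summable (\<lambda>m. C * exp (- a / 2 :: real) ^ m)"
  by (intro summable_mult summable_geometric) simp

lemma summable_theta:
  assumes "l > 0" 
  shows "summable (\<lambda>m. chi m * psi n (l * (2 * real m + 1) / 4))"
proof -
  obtain C where C: "C > 0" "\<And>x. \<bar>psi n x\<bar> \<le> C * exp (- \<bar>x\<bar>)"
    using psi_bound by blast
  show ?thesis
    by (rule summable_comparison_test'[where N = 0, OF summable_exp_power[OF assms, of C]])
       (use psi_term_bound[OF assms order_refl C(2,1)] in simp)
qed

lemma DERIV_theta: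
  assumes "l > 0"
  shows "(theta n has_real_derivative
     (2 * pi * real (n * (n - 1)) * theta (n - 2) l - theta n l / 2 - theta (n + 2) l / (8 * pi)) / l) (at l)"
proof -
  define a where "a = l / 2"
  have a: "0 < a" "a < l" using assms by (auto simp: a_def)
  \<comment> \<open>differentiation under the sum needs uniformity only locally, away from \<open>0\<close>\<close>
  define S where "S = {a<..<l + 1}"
  \<comment> \<open>the termwise derivative, written by \<open>mult_deriv_psi\<close> without a factor that grows with \<open>m\<close>\<close>
  define D where "D = (\<lambda>m x. (2 * pi * real (n * (n - 1)) * (chi m * psi (n - 2) (x * (2 * real m + 1) / 4)) - 
       chi m * psi n (x * (2 * real m + 1) / 4) / 2 - 
       chi m * psi (n + 2) (x * (2 * real m + 1) / 4) / (8 * pi)) / x)"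
  obtain C0 where C0: "C0 > 0" "\<And>x. \<bar>psi (n - 2) x\<bar> \<le> C0 * exp (- \<bar>x\<bar>)"
    using psi_bound by blast
  obtain C1 where C1: "C1 > 0" "\<And>x. \<bar>psi n x\<bar> \<le> C1 * exp (- \<bar>x\<bar>)"
    using psi_bound by blast
  obtain C2 where C2: "C2 > 0" "\<And>x. \<bar>psi (n + 2) x\<bar> \<le> C2 * exp (- \<bar>x\<bar>)"
    using psi_bound by blast
  define K where "K = (2 * pi * real (n * (n - 1)) * C0 + C1 / 2 + C2 / (8 * pi)) / a"
  have lim: "uniform_limit S (\<lambda>k x. \<Sum>m<k. D m x) (\<lambda>x. \<Sum>m. D m x) sequentially"
  proof (rule Weierstrass_m_test)
    show "summable (\<lambda>m. K * exp (- a / 2) ^ m)" by (rule summable_exp_power[OF a(1)])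
    fix m x assume "x \<in> S"
    then have x: "a < x" "a \<le> x" "0 < x" using a by (auto simp: S_def)
    define E where "E = exp (- a / 2) ^ m"
    have E: "E \<ge> 0" by (simp add: E_def)
    define u where "u = 2 * pi * real (n * (n - 1)) * (chi m * psi (n - 2) (x * (2 * real m + 1) / 4))"
    define v where "v = chi m * psi n (x * (2 * real m + 1) / 4) / 2"
    define w where "w = chi m * psi (n + 2) (x * (2 * real m + 1) / 4) / (8 * pi)"
    have u: "\<bar>u\<bar> \<le> 2 * pi * real (n * (n - 1)) * (C0 * E)" 
      unfolding u_def E_def abs_mult[of "2 * pi * real (n * (n - 1))"]
      using mult_left_mono[OF psi_term_bound[OF a(1) x(2) C0(2,1)], of "2 * pi * real (n * (n - 1))" m] 
      by simp
    have v: "\<bar>v\<bar> \<le> (C1 * E) / 2"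
      unfolding v_def E_def using psi_term_bound[OF a(1) x(2) C1(2,1), of m] by simp
    have w: "\<bar>w\<bar> \<le> (C2 * E) / (8 * pi)"
      unfolding w_def E_def abs_divide using psi_term_bound[OF a(1) x(2) C2(2,1), of m] 
      by (simp add: divide_right_mono)
    have "norm (D m x) = \<bar>u - v - w\<bar> / x" unfolding D_def u_def v_def w_def using x by simp
    also have "\<dots> \<le> (\<bar>u\<bar> + \<bar>v\<bar> + \<bar>w\<bar>) / a"
      using x a by (intro frac_le) auto
    also have "\<dots> \<le> (2 * pi * real (n * (n - 1)) * (C0 * E) + (C1 * E) / 2 + (C2 * E) / (8 * pi)) / a"
      using u v w a by (intro divide_right_mono add_mono) auto
    also have "\<dots> = K * E" unfolding K_def by (simp add: field_simps)
    finally show "norm (D m x) \<le> K * exp (- a / 2) ^ m" by (simp add: E_def)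
  qed
  have "((\<lambda>x. \<Sum>m. chi m * psi n (x * (2 * real m + 1) / 4)) has_real_derivative (\<Sum>m. D m l)) (at l)"
  proof (rule has_field_derivative_series'(2)[where S = S and x0 = l])
    show "convex S" "l \<in> S" "l \<in> interior S" using a 
      by (auto simp: S_def)
    show "uniformly_convergent_on S (\<lambda>k x. \<Sum>m<k. D m x)"
      using lim by (auto simp: uniformly_convergent_on_def)
    show "summable (\<lambda>m. chi m * psi n (l * (2 * real m + 1) / 4))"
      by (rule summable_theta[OF assms])
    fix m x assume "x \<in> S"
    then have x: "0 < x" using a by (auto simp: S_def)
    define c where "c = (2 * real m + 1) / 4"
    have "((\<lambda>x. chi m * psi n (x * c)) has_real_derivative
       chi m * ((2 * pi * real n * psi (n - 1) (x * c) - psi (Suc n) (x * c) / 2) * c)) (at x)"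
      by (rule DERIV_cmult DERIV_chain2[OF DERIV_psi] DERIV_cmult_right derivative_eq_intros refl)+ simp
    also have "chi m * ((2 * pi * real n * psi (n - 1) (x * c) - psi (Suc n) (x * c) / 2) * c) =
       chi m * ((x * c) * (2 * pi * real n * psi (n - 1) (x * c) - psi (Suc n) (x * c) / 2)) / x"
      using x by (simp add: field_simps)
    also have "\<dots> = D m x"
      unfolding mult_deriv_psi D_def c_def by (simp add: algebra_simps)
    finally have "((\<lambda>x. chi m * psi n (x * (2 * real m + 1) / 4)) has_real_derivative D m x) (at x)"
      by (simp add: c_def)
    then show "((\<lambda>x. chi m * psi n (x * (2 * real m + 1) / 4)) has_real_derivative D m x) (at x within S)"
      by (rule has_field_derivative_at_within)
  qed
  also have "(\<Sum>m. D m l) = (2 * pi * real (n * (n - 1)) * theta (n - 2) l - theta n l / 2 - theta (n + 2) l / (8 * pi)) / l"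
    unfolding D_def theta_def
    by (intro sums_unique[symmetric] sums_divide sums_diff sums_mult summable_sums summable_theta assms)
  finally show ?thesis by (simp add: theta_def[abs_def])
qed

lemma continuous_on_theta: "continuous_on {0<..} (theta n)"
  by (auto intro!: continuous_at_imp_continuous_on DERIV_isCont DERIV_theta)

text \<open>Write \<open>E n = l (theta n)' + theta n / 2\<close>. Differentiating \<open>theta n (2 / l) = s l theta n l\<close> gives
\<open>E n (2 / l) = - s l E n l\<close>: the operator \<open>l d/dl + 1/2\<close> anticommutes with the
reflection \<open>l \<mapsto> 2 / l\<close>. Since \<open>E n\<close> is a combination of \<open>theta (n - 2)\<close> and \<open>theta (n + 2)\<close>, the
functional equation climbs by two with alternating sign. The coefficient \<open>n (n - 1)\<close>
is kept in the second hypothesis so that \<open>n = 0\<close> is covered, where \<open>n - 2\<close> is again \<open>0\<close>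
and carries the wrong sign.\<close>

lemma theta_functional_step:
  assumes F: "\<And>l. l > 0 \<Longrightarrow> theta n (2 / l) = s * l * theta n l"
      and G: "\<And>l. l > 0 \<Longrightarrow> real (n * (n - 1)) * theta (n - 2) (2 / l) = - s * l * (real (n * (n - 1)) * theta (n - 2) l)"
      and l: "l > 0"
  shows "theta (n + 2) (2 / l) = - s * l * theta (n + 2) l"
proof -
  define D where "D = (\<lambda>l. 2 * pi * (real (n * (n - 1)) * theta (n - 2) l) - theta n l / 2 - theta (n + 2) l / (8 * pi))"
  have D: "(theta n has_real_derivative D l / l) (at l)" if "l > 0" for l
    using DERIV_theta[OF that, of n] by (simp add: D_def mult.assoc)
  have 1: "((\<lambda>l. theta n (2 / l)) has_real_derivative D (2 / l) / (2 / l) * (- 2 / l\<^sup>2)) (at l)"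
    by (rule DERIV_chain2[OF D])
       (use l in \<open>auto intro!: derivative_eq_intros simp: power2_eq_square\<close>)
  have 2: "((\<lambda>l. s * l * theta n l) has_real_derivative s * theta n l + s * l * (D l / l)) (at l)"
    using l by (auto intro!: derivative_eq_intros D)
  have 3: "((\<lambda>l. theta n (2 / l)) has_real_derivative s * theta n l + s * l * (D l / l)) (at l)"
    by (rule DERIV_cong_ev[THEN iffD1, OF refl _ refl 2])
       (use l F in \<open>auto intro!: eventually_nhds_in_open[of "{0<..}" l, THEN eventually_mono]\<close>)
  have "D (2 / l) / (2 / l) * (- 2 / l\<^sup>2) = s * theta n l + s * l * (D l / l)"
    using DERIV_unique[OF 1 3] .
  moreover have "D (2 / l) / (2 / l) * (- 2 / l\<^sup>2) = - D (2 / l) / l" 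
    using l by (simp add: power2_eq_square)
  ultimately have "- D (2 / l) / l = s * theta n l + s * D l" using l by simp
  then have "- D (2 / l) = (s * theta n l + s * D l) * l" 
    using l nonzero_divide_eq_eq[of l "- D (2 / l)" "s * theta n l + s * D l"] by blast
  then have "theta (n + 2) (2 / l) / (8 * pi) = (- s * l * theta (n + 2) l) / (8 * pi)"
  proof -
    have "U = - s * l * V" 
      if "- (2 * pi * (- s * l * R) - s * l * T / 2 - U) = (s * T + s * (2 * pi * R - T / 2 - V)) * l" 
      for R T U V
      using that by (simp add: algebra_simps) 
    from this[OF \<open>- D (2 / l) = _\<close>[unfolded D_def G[OF l] F[OF l]]] show ?thesis by simp
  qed
  moreover have "8 * pi \<noteq> 0" by simp
  ultimately show ?thesis using divide_cancel_right by blast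
qed

lemma even_nat_cases:
  fixes n :: nat
  assumes "even n" 
  obtains "n = 0" | m where "n = m + 2" "even m"
proof (cases "n = 0")
  case False
  then have "n \<ge> 2" using assms by presburger
  then show ?thesis using assms that(2)[of "n - 2"] by simp
qed

lemma theta_functional:
  assumes "even n" and F0: "\<And>l. l > 0 \<Longrightarrow> theta 0 (2 / l) = l / sqrt 2 * theta 0 l" and "l > 0"
  shows "theta n (2 / l) = (- 1) ^ (n div 2) / sqrt 2 * l * theta n l"
  using assms(1,3)
proof (induction n arbitrary: l rule: less_induct)
  case (less n)
  consider "n = 0" | m where "n = m + 2" "even m"
    using \<open>even n\<close> even_nat_cases by blast
  then show ?case
  proof cases
    case 1
    then show ?thesis using F0 less.prems by simp
  next
    case 2
    have "theta (m + 2) (2 / l) = - ((- 1) ^ (m div 2) / sqrt 2) * l * theta (m + 2) l"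
    proof (rule theta_functional_step)
      show "theta m (2 / l) = (- 1) ^ (m div 2) / sqrt 2 * l * theta m l" if "l > 0" for l
        using less.IH[of m l] 2 that by simp
      show "real (m * (m - 1)) * theta (m - 2) (2 / l) = - ((- 1) ^ (m div 2) / sqrt 2) * l * (real (m * (m - 1)) * theta (m - 2) l)" 
        if "l > 0" for l
      proof (cases "m = 0")
        case False
        then obtain k where k: "m = k + 2" "even k"
          using \<open>even m\<close> even_nat_cases by blast
        then show ?thesis using less.IH[of k l] 2 that by simp
      qed simp
    qed (use less.prems in auto)
    then show ?thesis using 2 by simp
  qed
qed

text \<open>At \<open>l = 4 x\<close> the series samples \<open>psi n\<close> at the odd multiples of its largest zero \<open>x\<close>. The first term
vanishes, and from \<open>3 x\<close> on \<open>psi n\<close> is strictly decreasing, because the lower bound for \<open>x\<close> gives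
\<open>\<pi> (3 x)\<^sup>2 > n\<close>. The remaining signs \<open>- - + +\<close> then make every block of four negative.\<close>

lemma theta_neg_at_last_zero:
  assumes "last_zero n x" "n \<ge> 3"
  shows "theta n (4 * x) < 0"
proof -
  define g where "g = (\<lambda>m. psi n (x * (2 * real m + 1)))"
  have b: "real n - 1 \<le> 4 * pi * x\<^sup>2" by (rule last_zero_lower_bound[OF assms])
  have x: "x > 0"
  proof (rule ccontr)
    assume "\<not> x > 0"
    then have "x = 0" using assms by (simp add: last_zero_def)
    then show False using b assms by simp
  qed
  have n3: "real n < pi * (3 * x)\<^sup>2" 
  proof -
    have "9 * (real n - 1) \<le> 9 * (4 * pi * x\<^sup>2)" using b by (rule mult_left_mono) simp
    moreover have "4 * real n < 9 * (real n - 1)" using assms(2) by simp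
    ultimately show ?thesis by (simp add: power2_eq_square algebra_simps)
  qed
  have dec: "g k < g m" if "m \<ge> 1" "m < k" for m k
    unfolding g_def
  proof (rule psi_strict_decreasing)
    have "3 * x \<le> (2 * real m + 1) * x" using that x by (intro mult_right_mono) auto
    then have "(3 * x)\<^sup>2 \<le> (x * (2 * real m + 1))\<^sup>2"
      using x by (intro power_mono) (auto simp: mult.commute)
    then have "pi * (3 * x)\<^sup>2 \<le> pi * (x * (2 * real m + 1))\<^sup>2" by (rule mult_left_mono) simp
    then show "real n < pi * (x * (2 * real m + 1))\<^sup>2" using n3 by linarith
  qed (use x that in auto)
  define f where "f = (\<lambda>m. chi m * psi n (4 * x * (2 * real m + 1) / 4))"
  have fg: "f m = chi m * g m" for m by (simp add: f_def g_def)
  have sf: "summable f" unfolding f_def using summable_theta[of "4 * x" n] x by simp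
  have f0: "f 0 = 0" using assms by (simp add: f_def last_zero_def psi_def)
  have "theta n (4 * x) = (\<Sum>m. f (m + 1)) + f 0"
    unfolding theta_def f_def[symmetric] 
    using suminf_split_head[OF sf] by simp
  moreover have s1: "(\<lambda>m. f (m + 1)) sums (\<Sum>m. f (m + 1))"
    using sf by (intro summable_sums) (rule summable_ignore_initial_segment)
  have s4: "(\<lambda>k. sum (\<lambda>m. f (m + 1)) {k * 4..<k * 4 + 4}) sums (\<Sum>m. f (m + 1))"
    by (rule sums_group[OF s1]) simp
  have blk: "sum (\<lambda>m. f (m + 1)) {k * 4..<k * 4 + 4} < 0" for k
  proof -
    have "{k * 4..<k * 4 + 4} = {4 * k, 4 * k + 1, 4 * k + 2, 4 * k + 3}" by auto
    then have "sum (\<lambda>m. f (m + 1)) {k * 4..<k * 4 + 4} = f (4 * k + 1) + f (4 * k + 2) + f (4 * k + 3) + f (4 * k + 4)"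
      by (simp add: eval_nat_numeral)
    also have "\<dots> = - g (4 * k + 1) - g (4 * k + 2) + g (4 * k + 3) + g (4 * k + 4)"
    proof -
      have "Suc (4 * k + 1) div 2 = 2 * k + 1" "Suc (4 * k + 2) div 2 = 2 * k + 1" 
        "Suc (4 * k + 3) div 2 = 2 * k + 2" "Suc (4 * k + 4) div 2 = 2 * k + 2" by presburger+
      then show ?thesis unfolding fg chi_def by simp
    qed
    also have "\<dots> < 0" using dec[of "4 * k + 1" "4 * k + 3"] dec[of "4 * k + 2" "4 * k + 4"] by simp
    finally show ?thesis .
  qed
  have "(\<Sum>m. f (m + 1)) < 0"
  proof -
    note s = sums_minus[OF s4]
    have "0 < (\<Sum>k. - sum (\<lambda>m. f (m + 1)) {k * 4..<k * 4 + 4})"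
      by (rule suminf_pos[OF sums_summable[OF s]]) (use blk in simp)
    then show ?thesis unfolding sums_unique[OF s, symmetric] by simp
  qed
  ultimately show ?thesis using f0 by simp
qed

text \<open>For large \<open>l\<close> consecutive samples drop by more than a factor two, so in each block
\<open>+ - - +\<close> the first term outweighs the two negative ones.\<close>

lemma theta_pos_large:
  assumes "l \<ge> 4 * (real n + 1)"
  shows "theta n l > 0"
proof -
  define g where "g = (\<lambda>m. psi n (l * (2 * real m + 1) / 4))"
  have l: "l > 0" using assms by simp
  have half: "g k < g m / 2 \<and> g m > 0" if "m < k" for m k
  proof -
    have ge: "l / 4 * 1 \<le> l / 4 * (2 * real m + 1)"
      using l by (intro mult_left_mono) auto
    have 1: "real n + 1 \<le> l * (2 * real m + 1) / 4" 
    proof -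
      have "real n + 1 \<le> l / 4 * 1" using assms by simp
      also note ge
      finally show ?thesis by (simp only: times_divide_eq_left)
    qed
    have "l * (2 * real k + 1) / 4 - l * (2 * real m + 1) / 4 = l / 2 * (real k - real m)"
      by (simp add: field_simps)
    moreover have "l / 2 * (real k - real m) \<ge> l / 2 * 1" 
      using that l by (intro mult_left_mono) auto
    moreover have "l / 2 \<ge> 2" using assms by simp
    ultimately have 2: "l * (2 * real m + 1) / 4 - l * (2 * real k + 1) / 4 \<le> - 1" by linarith
    have pos: "g m > 0"
      unfolding g_def using 1 by (intro psi_pos_large pi_square_ge) linarith+
    have "g k \<le> exp (l * (2 * real m + 1) / 4 - l * (2 * real k + 1) / 4) * g m"
      unfolding g_def using 1 2 by (intro psi_exponential_decay) auto
    also have "\<dots> \<le> exp (- 1) * g m" using 2 pos by (intro mult_right_mono) auto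
    \<comment> \<open>consecutive arguments differ by \<open>l / 2 \<ge> 2\<close>, and \<open>1 / e < 1 / 2\<close>\<close>
    also have "\<dots> < 1 / 2 * g m"
    proof (rule mult_strict_right_mono[OF _ pos])
      have "exp 1 > (2 :: real)" using exp_lower_Taylor_quadratic[of 1] by simp
      then show "exp (- 1) < (1 / 2 :: real)" by (simp add: exp_minus field_simps)
    qed
    finally show ?thesis using pos by simp
  qed
  define f where "f = (\<lambda>m. chi m * psi n (l * (2 * real m + 1) / 4))"
  have fg: "f m = chi m * g m" for m by (simp add: f_def g_def)
  have s1: "f sums theta n l" unfolding f_def theta_def
    by (rule summable_sums[OF summable_theta[OF l]])
  have s4: "(\<lambda>k. sum f {k * 4..<k * 4 + 4}) sums theta n l"
    by (rule sums_group[OF s1]) simp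
  have blk: "sum f {k * 4..<k * 4 + 4} > 0" for k
  proof -
    have "{k * 4..<k * 4 + 4} = {4 * k, 4 * k + 1, 4 * k + 2, 4 * k + 3}" by auto
    then have "sum f {k * 4..<k * 4 + 4} = f (4 * k) + f (4 * k + 1) + f (4 * k + 2) + f (4 * k + 3)"
      by (simp add: eval_nat_numeral)
    also have "\<dots> = g (4 * k) - g (4 * k + 1) - g (4 * k + 2) + g (4 * k + 3)"
    proof -
      have "Suc (4 * k) div 2 = 2 * k" "Suc (4 * k + 1) div 2 = 2 * k + 1" "Suc (4 * k + 2) div 2 = 2 * k + 1" 
        "Suc (4 * k + 3) div 2 = 2 * k + 2" by presburger+
      then show ?thesis unfolding fg chi_def by simp
    qed
    also have "\<dots> > 0" 
      using half[of "4 * k" "4 * k + 1"] half[of "4 * k" "4 * k + 2"] half[of "4 * k + 3" "4 * k + 4"] by simp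
    finally show ?thesis .
  qed
  show ?thesis
    using suminf_pos[OF sums_summable[OF s4] blk] sums_unique[OF s4] by simp
qed

text \<open>The sign change lies to the right of \<open>4 x\<close>, and \<open>16 x\<^sup>2 \<ge> 4 (n - 1) / \<pi> \<ge> 12 / \<pi> > 2\<close>. For \<open>n = 2\<close> the
largest zero is too small for this last step.\<close>

lemma ex_theta_zero:
  assumes "n \<ge> 4"
  obtains l where "l > sqrt 2" "theta n l = 0"
proof -
  obtain x where x: "last_zero n x" using ex_last_zero[of n] assms by auto
  have b: "real n - 1 \<le> 4 * pi * x\<^sup>2" using last_zero_lower_bound[OF x] assms by simp
  have "3 \<le> 4 * pi * x\<^sup>2" using b assms by simp
  also have "\<dots> \<le> 4 * 4 * x\<^sup>2" using pi_less_4 by (intro mult_right_mono) auto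
  finally have "2 < (4 * x)\<^sup>2" by (simp add: power2_eq_square)
  moreover have "x \<ge> 0" using x by (simp add: last_zero_def)
  ultimately have s: "sqrt 2 < 4 * x" by (intro real_less_lsqrt) auto
  then have x0: "x > 0" by (smt (verit) real_sqrt_gt_zero)
  define L where "L = max (4 * x) (4 * (real n + 1))"
  have "\<exists>l\<ge>4 * x. l \<le> L \<and> theta n l = 0"
  proof (rule IVT')
    show "theta n (4 * x) \<le> 0" using theta_neg_at_last_zero[OF x] assms by simp
    show "0 \<le> theta n L" using theta_pos_large[of n L] by (simp add: L_def)
    show "continuous_on {4 * x..L} (theta n)"
      by (rule continuous_on_subset[OF continuous_on_theta]) (use x0 in auto)
  qed (simp add: L_def)
  then obtain l where "4 * x \<le> l" "theta n l = 0" by blast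
  then show ?thesis using s by (intro that[of l]) auto
qed

section \<open>Poisson summation for Gaussians\<close>

lemma integral_gauss_cos:
  fixes a s :: real
  assumes a: "a > 0"
  shows "integrable lborel (\<lambda>x. exp (- a * x\<^sup>2) * cos (s * x))"
    and "(LINT x|lborel. exp (- a * x\<^sup>2) * cos (s * x)) = sqrt (pi / a) * exp (- s\<^sup>2 / (4 * a))"
proof -
  define c where "c = sqrt (2 * a)"
  have c: "c > 0" "c\<^sup>2 = 2 * a" using a by (auto simp: c_def)
  define h where "h = (\<lambda>y. std_normal_density y * cos (s / c * y))"
  have int_h: "integrable lborel h"
    unfolding h_def
    by (rule Bochner_Integration.integrable_bound[OF integrable_normal_density[of 1 0]])
       (auto simp: abs_mult intro!: mult_left_le)
  have "complex_of_real (exp (- (s / c)\<^sup>2 / 2)) = char std_normal_distribution (s / c)"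
    by (simp add: char_std_normal_distribution)
  also have "\<dots> = (CLINT x|lborel. complex_of_real (std_normal_density x) * iexp (s / c * x))"
    unfolding char_def
    by (subst integral_density) (auto simp: scaleR_conv_of_real)
  finally have "exp (- (s / c)\<^sup>2 / 2) = Re (CLINT x|lborel. complex_of_real (std_normal_density x) * iexp (s / c * x))"
    by (metis Re_complex_of_real)
  also have "\<dots> = (LINT x|lborel. Re (complex_of_real (std_normal_density x) * iexp (s / c * x)))"
  proof (rule integral_Re[symmetric])
    show "integrable lborel (\<lambda>x. complex_of_real (std_normal_density x) * iexp (s / c * x))"
      by (rule Bochner_Integration.integrable_bound[OF integrable_normal_density[of 1 0]])
         (auto simp: norm_mult)
  qed
  also have "\<dots> = (LINT x|lborel. h x)"
    by (rule Bochner_Integration.integral_cong) (auto simp: h_def Re_exp)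
  finally have hval: "(LINT x|lborel. h x) = exp (- (s / c)\<^sup>2 / 2)" ..
  have eq: "exp (- a * x\<^sup>2) * cos (s * x) = sqrt (2 * pi) * h (0 + c * x)" for x
    using c by (simp add: h_def std_normal_density_def power_mult_distrib)
  show "integrable lborel (\<lambda>x. exp (- a * x\<^sup>2) * cos (s * x))"
    unfolding eq using lborel_integrable_real_affine[OF int_h, of c 0] c by simp
  have "(LINT x|lborel. h x) = c * (LINT x|lborel. h (0 + c * x))"
    using lborel_integral_real_affine[of c h 0] c by simp
  then have "(LINT x|lborel. h (0 + c * x)) = exp (- (s / c)\<^sup>2 / 2) / c"
    using hval c by (simp add: field_simps)
  then have "(LINT x|lborel. exp (- a * x\<^sup>2) * cos (s * x)) = sqrt (2 * pi) * (exp (- (s / c)\<^sup>2 / 2) / c)"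
    unfolding eq by simp
  also have "\<dots> = sqrt (2 * pi) / c * exp (- s\<^sup>2 / (4 * a))"
    using c by (simp add: power_divide)
  also have "sqrt (2 * pi) / c = sqrt (pi / a)"
    unfolding c_def by (simp flip: real_sqrt_divide)
  finally show "(LINT x|lborel. exp (- a * x\<^sup>2) * cos (s * x)) = sqrt (pi / a) * exp (- s\<^sup>2 / (4 * a))" .
qed

lemma integral_gauss_cos_lim:
  assumes a: "a > 0"
  shows "(\<lambda>K. integral {- real (2 * K)..real (2 * K)} (\<lambda>x. exp (- a * x\<^sup>2) * cos (s * x)))
     \<longlonglongrightarrow> sqrt (pi / a) * exp (- s\<^sup>2 / (4 * a))"
proof -
  let ?f = "\<lambda>x. exp (- a * x\<^sup>2) * cos (s * x)"
  let ?S = "\<lambda>K. {- real (2 * K)..real (2 * K)}"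
  note int = integral_gauss_cos[OF a, of s]
  have "(\<lambda>K. LINT x|lborel. indicator (?S K) x *\<^sub>R ?f x) \<longlonglongrightarrow> (LINT x|lborel. ?f x)"
  proof (rule integral_dominated_convergence[where w = "\<lambda>x. norm (?f x)"])
    show "integrable lborel (\<lambda>x. norm (?f x))" using int(1) by (rule integrable_norm)
    have "(\<lambda>K. indicator (?S K) x *\<^sub>R ?f x) \<longlonglongrightarrow> ?f x" for x
    proof (rule tendsto_eventually)
      obtain N :: nat where "real N \<ge> \<bar>x\<bar>" using real_arch_simple by blast
      then have "indicator (?S K) x *\<^sub>R ?f x = ?f x" if "K \<ge> N" for K
        using that by (auto simp: indicator_def)
      then show "\<forall>\<^sub>F K in sequentially. indicator (?S K) x *\<^sub>R ?f x = ?f x"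
        by (auto simp: eventually_sequentially)
    qed
    then show "AE x in lborel. (\<lambda>K. indicator (?S K) x *\<^sub>R ?f x) \<longlonglongrightarrow> ?f x" by simp
  qed (auto simp: indicator_def)
  moreover have "(LINT x|lborel. indicator (?S K) x *\<^sub>R ?f x) = integral (?S K) ?f" for K
    unfolding set_lebesgue_integral_def[symmetric]
    by (rule set_borel_integral_eq_integral(2))
       (unfold set_integrable_def, rule integrable_mult_indicator[OF _ int(1)], simp)
  ultimately show ?thesis using int(2) by simp
qed


text \<open>A function that is symmetric about \<open>1\<close> is a continuous function of \<open>cos (\<pi> x)\<close>, so Weierstrass
approximation by polynomials in \<open>cos (\<pi> x)\<close> applies, and these are spanned by the
\<open>cos (\<pi> i x)\<close>. Hence \<open>D\<close> is orthogonal to itself.\<close>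

lemma fourier_cos_unique:
  fixes D :: "real \<Rightarrow> real"
  assumes cont: "continuous_on {0..2} D"
    and sym: "\<And>x. x \<in> {0..2} \<Longrightarrow> D (2 - x) = D x"
    and orth: "\<And>i. integral {0..2} (\<lambda>x. D x * cos (pi * real i * x)) = 0"
    and x: "x \<in> {0..2}"
  shows "D x = 0"
proof -
  have orth': "integral {0..2} (\<lambda>x. D x * (cos (pi * x) ^ j * cos (pi * real i * x))) = 0" for j i
  proof (induction j arbitrary: i)
    case 0
    then show ?case using orth by simp
  next
    case (Suc j)
    let ?g = "\<lambda>i x. D x * (cos (pi * x) ^ j * cos (pi * real i * x))"
    have int: "?g i integrable_on {0..2}" for i
      by (intro integrable_continuous_real continuous_intros cont)
    show ?case
    proof (cases i)
      case 0
      have "(\<lambda>x. D x * (cos (pi * x) ^ Suc j * cos (pi * real i * x))) = ?g 1"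
        by (auto simp: 0 fun_eq_iff)
      then show ?thesis using Suc.IH[of 1] by simp
    next
      case (Suc k)
      have "D x * (cos (pi * x) ^ Suc j * cos (pi * real i * x)) = (?g (k + 2) x + ?g k x) / 2" for x
      proof -
        have "cos (pi * real (k + 2) * x) + cos (pi * real k * x) = 2 * (cos (pi * x) * cos (pi * real i * x))"
          using cos_times_cos[of "pi * real i * x" "pi * x"] by (simp add: Suc algebra_simps)
        moreover have "(?g (k + 2) x + ?g k x) / 2 = D x * cos (pi * x) ^ j * (cos (pi * real (k + 2) * x) + cos (pi * real k * x)) / 2"
          by (simp add: algebra_simps)
        ultimately show ?thesis by simp
      qed
      then have "integral {0..2} (\<lambda>x. D x * (cos (pi * x) ^ Suc j * cos (pi * real i * x))) =
          integral {0..2} (\<lambda>x. (?g (k + 2) x + ?g k x) / 2)"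
        by (simp only:)
      also have "\<dots> = (integral {0..2} (?g (k + 2)) + integral {0..2} (?g k)) / 2"
        using int[of "k + 2"] int[of k] by (simp add: Henstock_Kurzweil_Integration.integral_add)
      also have "\<dots> = 0" by (simp only: Suc.IH) simp
      finally show ?thesis .
    qed
  qed
  have poly: "integral {0..2} (\<lambda>x. D x * p (cos (pi * x))) = 0" if p: "real_polynomial_function p" for p
  proof -
    obtain b n where p: "p = (\<lambda>x. \<Sum>i\<le>n. b i * x ^ i)"
      using p real_polynomial_function_iff_sum[of p] by blast
    have "integral {0..2} (\<lambda>x. D x * p (cos (pi * x))) = 
        integral {0..2} (\<lambda>x. \<Sum>i\<le>n. b i * (D x * (cos (pi * x) ^ i * cos (pi * real 0 * x))))"
      by (simp add: p sum_distrib_left mult_ac)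
    also have "\<dots> = (\<Sum>i\<le>n. integral {0..2} (\<lambda>x. b i * (D x * (cos (pi * x) ^ i * cos (pi * real 0 * x)))))"
      by (intro Henstock_Kurzweil_Integration.integral_sum integrable_continuous_real continuous_intros cont) auto
    also have "\<dots> = 0" using orth'[of _ 0] by (simp only: integral_mult_right) simp
    finally show ?thesis .
  qed
  define E where "E = (\<lambda>c. D (arccos c / pi))"
  have E: "D x = E (cos (pi * x))" if "x \<in> {0..2}" for x
  proof (cases "x \<le> 1")
    case True
    then have "arccos (cos (pi * x)) = pi * x" using that by (intro arccos_cos) auto
    then show ?thesis by (simp add: E_def)
  next
    case False
    have "cos (pi * x) = cos (pi * (2 - x))" 
      by (simp add: right_diff_distrib cos_diff mult.commute[of pi 2])
    moreover have "arccos (cos (pi * (2 - x))) = pi * (2 - x)" using that False by (intro arccos_cos) auto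
    ultimately show ?thesis using sym[OF that] by (simp add: E_def)
  qed
  have contE: "continuous_on {-1..1} E"
    unfolding E_def
  proof (rule continuous_on_compose2[OF cont])
    have "0 \<le> arccos y / pi \<and> arccos y / pi \<le> 2" if "y \<in> {-1..1}" for y
      using that arccos_lbound[of y] arccos_ubound[of y] pi_gt_zero
      by (auto simp: field_simps simp del: pi_gt_zero)
    then show "(\<lambda>c. arccos c / pi) ` {-1..1} \<subseteq> {0..2}" by auto
  qed (auto intro!: continuous_intros continuous_on_arccos')
  have cD: "continuous_on {0..2} (\<lambda>x. \<bar>D x\<bar>)" by (intro continuous_intros cont)
  define M where "M = integral {0..2} (\<lambda>x. \<bar>D x\<bar>)"
  have M: "M \<ge> 0" unfolding M_def by (rule integral_nonneg[OF integrable_continuous_real[OF cD]]) auto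
  have "integral {0..2} (\<lambda>x. D x * D x) \<le> 0 + e" if "e > 0" for e
  proof -
    define d where "d = e / (M + 1)"
    have d: "d > 0" using that M by (simp add: d_def)
    obtain p where p: "real_polynomial_function p" "\<And>c. c \<in> {-1..1} \<Longrightarrow> \<bar>E c - p c\<bar> < d"
      using Stone_Weierstrass_real_polynomial_function[OF _ contE d] by auto
    have cp: "continuous_on {0..2} (\<lambda>x. p (cos (pi * x)))"
      by (rule continuous_on_compose2[OF continuous_on_polymonial_function[of p UNIV]])
         (use p(1) in \<open>auto simp: real_polynomial_function_eq intro!: continuous_intros\<close>)
    have "integral {0..2} (\<lambda>x. D x * D x) = integral {0..2} (\<lambda>x. D x * D x) - integral {0..2} (\<lambda>x. D x * p (cos (pi * x)))"
      using poly[OF p(1)] by simp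
    also have "\<dots> = integral {0..2} (\<lambda>x. D x * D x - D x * p (cos (pi * x)))"
      by (intro Henstock_Kurzweil_Integration.integral_diff[symmetric] integrable_continuous_real continuous_intros cont cp)
    also have "\<dots> \<le> integral {0..2} (\<lambda>x. d * \<bar>D x\<bar>)"
    proof (intro integral_le integrable_continuous_real continuous_intros cont cp)
      fix x :: real assume x: "x \<in> {0..2}"
      have "\<bar>E (cos (pi * x)) - p (cos (pi * x))\<bar> < d" by (rule p(2)) auto
      then have "\<bar>D x\<bar> * \<bar>D x - p (cos (pi * x))\<bar> \<le> \<bar>D x\<bar> * d"
        using E[OF x] by (intro mult_left_mono) auto
      then have "\<bar>D x * (D x - p (cos (pi * x)))\<bar> \<le> d * \<bar>D x\<bar>"
        by (simp add: abs_mult mult.commute)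
      then show "D x * D x - D x * p (cos (pi * x)) \<le> d * \<bar>D x\<bar>"
        using abs_ge_self[of "D x * (D x - p (cos (pi * x)))"] 
        unfolding right_diff_distrib by linarith
    qed
    also have "\<dots> = d * M" unfolding M_def by simp
    also have "\<dots> \<le> e" using that M by (simp add: d_def field_simps)
    finally show ?thesis by simp
  qed
  then have "integral {0..2} (\<lambda>x. D x * D x) \<le> 0" by (rule field_le_epsilon)
  moreover have "integral {0..2} (\<lambda>x. D x * D x) \<ge> 0"
    by (rule integral_nonneg) (auto intro!: integrable_continuous_real continuous_intros cont)
  ultimately have "integral {0..2} (\<lambda>x. D x * D x) = 0" by simp
  moreover have "continuous_on {0..2} (\<lambda>x. D x * D x)" by (intro continuous_intros cont)
  ultimately have "\<forall>x\<in>{0..2}. D x * D x = 0"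
    using integral_eq_0_iff[of 0 2 "\<lambda>x. D x * D x"] by simp
  then have "D x * D x = 0" using x by blast
  then show ?thesis by simp
qed

text \<open>The sum over \<open>k\<close> is the 2-periodization of the Gaussian. The shift by \<open>2 k\<close> is paired with the one
by \<open>- 2 (k + 1)\<close>, so that each term is symmetric about \<open>1\<close> and the first \<open>K\<close> terms unfold to the
integral over \<open>[- 2 K, 2 K]\<close>.\<close>

definition gauss_pair :: "real \<Rightarrow> nat \<Rightarrow> real \<Rightarrow> real" where
  "gauss_pair a k x = exp (- a * (x + 2 * real k)\<^sup>2) + exp (- a * (x - 2 - 2 * real k)\<^sup>2)"

lemma gauss_pair_bound:
  assumes a: "a > 0" and x: "x \<in> {0..2}"
  shows "norm (gauss_pair a k x) \<le> 2 * exp (- a) ^ (k - 1)"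
proof (cases k)
  case 0
  have "exp (- a * (x + 2 * real k)\<^sup>2) \<le> 1" "exp (- a * (x - 2 - 2 * real k)\<^sup>2) \<le> 1"
    using a by (auto simp: mult_nonneg_nonneg)
  then have "gauss_pair a k x \<le> 2" unfolding gauss_pair_def by linarith
  then show ?thesis by (simp add: 0 gauss_pair_def)
next
  case (Suc j)
  have gen: "exp (- a * y\<^sup>2) \<le> exp (- a) ^ j" if "y\<^sup>2 \<ge> (2 * real k)\<^sup>2" for y
  proof -
    have "real j * 1 \<le> real k * real k" unfolding Suc by (intro mult_mono) auto
    also have "\<dots> \<le> (2 * real k)\<^sup>2" by (simp add: power2_eq_square)
    finally have "real j \<le> y\<^sup>2" using that by simp
    then have "a * real j \<le> a * y\<^sup>2" using a by (intro mult_left_mono) auto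
    then have "exp (- a * y\<^sup>2) \<le> exp (real j * (- a))" by (simp add: mult.commute)
    then show ?thesis by (simp only: exp_of_nat_mult)
  qed
  have "(2 * real k)\<^sup>2 \<le> (x + 2 * real k)\<^sup>2" using x by (intro power_mono) auto
  moreover have "(2 * real k)\<^sup>2 \<le> (2 + 2 * real k - x)\<^sup>2" using x by (intro power_mono) auto
  then have "(2 * real k)\<^sup>2 \<le> (x - 2 - 2 * real k)\<^sup>2" by (simp add: power2_eq_square algebra_simps)
  ultimately have "gauss_pair a k x \<le> exp (- a) ^ j + exp (- a) ^ j"
    unfolding gauss_pair_def by (intro add_mono gen)
  moreover have "gauss_pair a k x \<ge> 0" by (simp add: gauss_pair_def)
  ultimately show ?thesis by (simp add: Suc)
qed

lemma integral_gauss_pair_sum: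
  "((\<lambda>x. (\<Sum>k<K. gauss_pair a k x) * cos (pi * real i * x)) has_integral
    integral {- real (2 * K)..real (2 * K)} (\<lambda>x. exp (- a * x\<^sup>2) * cos (pi * real i * x))) {0..2}"
proof (induction K)
  case 0
  then show ?case by simp
next
  case (Suc K)
  let ?f = "\<lambda>x. exp (- a * x\<^sup>2) * cos (pi * real i * x)"
  have int: "?f integrable_on {u..v}" for u v
    by (intro integrable_continuous_real continuous_intros)
  have per: "cos (pi * real i * (x + 2 * real k)) = cos (pi * real i * x)" for x and k :: nat
    using cos.plus_of_nat[of "pi * real i * x" "i * k"] by (simp add: algebra_simps)
  have r: "((\<lambda>x. exp (- a * (x + 2 * real K)\<^sup>2) * cos (pi * real i * x)) has_integral
      integral {real (2 * K)..real (2 * Suc K)} ?f) {0..2}"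
  proof -
    have "((?f \<circ> (+) (2 * real K)) has_integral integral {real (2 * K)..real (2 * Suc K)} ?f) {0..2}"
      unfolding has_integral_shift_Icc_real using integrable_integral[OF int[of "2 * real K" "2 + 2 * real K"]]
      by simp
    then show ?thesis using per[of _ K] by (simp add: o_def add.commute)
  qed
  have l: "((\<lambda>x. exp (- a * (x - 2 - 2 * real K)\<^sup>2) * cos (pi * real i * x)) has_integral
      integral {- real (2 * Suc K)..- real (2 * K)} ?f) {0..2}"
  proof -
    have "((?f \<circ> (+) (- 2 - 2 * real K)) has_integral integral {- real (2 * Suc K)..- real (2 * K)} ?f) {0..2}"
      unfolding has_integral_shift_Icc_real using integrable_integral[OF int[of "- 2 - 2 * real K" "- 2 * real K"]]
      by (simp add: algebra_simps)
    moreover have "cos (pi * real i * (- 2 - 2 * real K + x)) = cos (pi * real i * x)" for x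
      using per[of "- 2 - 2 * real K + x" "Suc K"] by (simp add: algebra_simps)
    ultimately show ?thesis by (simp add: o_def algebra_simps)
  qed
  have unfold_ends: "integral {- real (2 * Suc K)..real (2 * Suc K)} ?f = 
      integral {- real (2 * Suc K)..- real (2 * K)} ?f + integral {- real (2 * K)..real (2 * K)} ?f
      + integral {real (2 * K)..real (2 * Suc K)} ?f"
    by (subst Henstock_Kurzweil_Integration.integral_combine[OF _ _ int], simp, simp)
       (rule Henstock_Kurzweil_Integration.integral_combine[OF _ _ int, symmetric], auto)
  show ?case
    unfolding unfold_ends
    by (rule has_integral_eq[OF _ has_integral_add[OF has_integral_add[OF l Suc] r]])
       (simp add: gauss_pair_def algebra_simps)
qed

lemma integral_cos_pi:
  assumes "(m :: int) \<noteq> 0"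
  shows "((\<lambda>x. cos (pi * of_int m * x)) has_integral 0) {0..2}"
proof -
  have "((\<lambda>x. cos (pi * of_int m * x)) has_integral
     (sin (pi * of_int m * 2) / (pi * of_int m) - sin (pi * of_int m * 0) / (pi * of_int m))) {0..2}"
    by (rule fundamental_theorem_of_calculus)
       (use assms in \<open>auto intro!: derivative_eq_intros simp flip: has_real_derivative_iff_has_vector_derivative\<close>)
  moreover have "sin (pi * of_int m * 2) = 0"
    using sin_int_2pin[of m] by (simp add: mult_ac)
  ultimately show ?thesis by simp
qed

lemma integral_cos_cos_pi:
  "((\<lambda>x. cos (pi * real (Suc j) * x) * cos (pi * real i * x)) has_integral (if i = Suc j then 1 else 0)) {0..2}"
proof -
  have eq: "cos (pi * real (Suc j) * x) * cos (pi * real i * x) =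
     (cos (pi * of_int (int (Suc j) - int i) * x) + cos (pi * of_int (int (Suc j) + int i) * x)) / 2" for x
    unfolding cos_times_cos by (simp add: algebra_simps)
  have 1: "((\<lambda>x. cos (pi * of_int (int (Suc j) + int i) * x)) has_integral 0) {0..2}"
    by (rule integral_cos_pi) linarith
  have 2: "((\<lambda>x. cos (pi * of_int (int (Suc j) - int i) * x)) has_integral (if i = Suc j then 2 else 0)) {0..2}"
  proof (cases "i = Suc j")
    case True
    then show ?thesis using has_integral_const_real[of "1::real" 0 2] by simp
  next
    case False
    then show ?thesis using integral_cos_pi[of "int (Suc j) - int i"] by simp
  qed
  show ?thesis unfolding eq
    using has_integral_divide[OF has_integral_add[OF 2 1], of 2] by (auto split: if_splits)
qed

text \<open>Both sides are uniform limits on \<open>[0, 2]\<close> with the same cosine coefficients, the coefficients of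
the left side being Fourier integrals of the Gaussian by unfolding. They agree by
\<open>fourier_cos_unique\<close>.\<close>

lemma gauss_poisson:
  fixes a x :: real
  assumes a: "a > 0" and x: "x \<in> {0..2}"
  defines "c \<equiv> \<lambda>j::nat. sqrt (pi / a) * exp (- (pi * real j)\<^sup>2 / (4 * a))"
  shows "(\<lambda>k. gauss_pair a k x) sums (\<Sum>k. gauss_pair a k x)"
    and "summable (\<lambda>j. c (Suc j) * cos (pi * real (Suc j) * x))"
    and "(\<Sum>k. gauss_pair a k x) = c 0 / 2 + (\<Sum>j. c (Suc j) * cos (pi * real (Suc j) * x))"
proof -
  define q where "q = exp (- pi\<^sup>2 / (4 * a))"
  have q: "0 < q" "q < 1" using a by (auto simp: q_def)
  have M1: "summable (\<lambda>k. 2 * exp (- a) ^ (k - 1))"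
    by (subst summable_Suc_iff[symmetric]) (use a in \<open>auto intro!: summable_mult summable_geometric\<close>)
  have M2: "summable (\<lambda>j. sqrt (pi / a) * q ^ Suc j)"
    using q by (intro summable_mult summable_Suc_iff[THEN iffD2] summable_geometric) auto
  have c_bound: "\<bar>c (Suc j) * cos (pi * real (Suc j) * y)\<bar> \<le> sqrt (pi / a) * q ^ Suc j" for j y
  proof -
    have "real (Suc j) * 1 \<le> (real (Suc j))\<^sup>2" unfolding power2_eq_square by (rule mult_left_mono) auto
    then have "pi\<^sup>2 / (4 * a) * real (Suc j) \<le> pi\<^sup>2 / (4 * a) * (real (Suc j))\<^sup>2"
      using a by (intro mult_left_mono) auto
    then have "exp (- (pi * real (Suc j))\<^sup>2 / (4 * a)) \<le> exp (real (Suc j) * (- pi\<^sup>2 / (4 * a)))"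
      by (simp add: power_mult_distrib mult_ac del: of_nat_Suc)
    also have "\<dots> = q ^ Suc j" unfolding q_def exp_of_nat_mult ..
    finally have *: "c (Suc j) \<le> sqrt (pi / a) * q ^ Suc j"
      unfolding c_def using a by (intro mult_left_mono) auto
    have "\<bar>c (Suc j) * cos (pi * real (Suc j) * y)\<bar> \<le> \<bar>c (Suc j)\<bar> * 1"
      unfolding abs_mult by (intro mult_left_mono) auto
    also have "\<bar>c (Suc j)\<bar> * 1 = c (Suc j)" using a by (simp add: c_def)
    finally show ?thesis using * by simp
  qed
  define P where "P = (\<lambda>y. \<Sum>k. gauss_pair a k y)"
  define R where "R = (\<lambda>y. \<Sum>j. c (Suc j) * cos (pi * real (Suc j) * y))"
  have sP: "summable (\<lambda>k. gauss_pair a k y)" if "y \<in> {0..2}" for y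
    by (rule summable_comparison_test'[OF M1, where N = 0]) (use gauss_pair_bound[OF a that] in auto)
  have sR: "summable (\<lambda>j. c (Suc j) * cos (pi * real (Suc j) * y))" for y
    by (rule summable_comparison_test'[OF M2, where N = 0]) (use c_bound in \<open>auto simp del: of_nat_Suc power_Suc\<close>)
  show "(\<lambda>k. gauss_pair a k x) sums (\<Sum>k. gauss_pair a k x)" using sP[OF x] by (rule summable_sums)
  show "summable (\<lambda>j. c (Suc j) * cos (pi * real (Suc j) * x))" by (rule sR)
  have uP: "uniform_limit {0..2} (\<lambda>K y. \<Sum>k<K. gauss_pair a k y) P sequentially"
    unfolding P_def by (rule Weierstrass_m_test[OF gauss_pair_bound[OF a] M1])
  have uR: "uniform_limit {0..2} (\<lambda>K y. \<Sum>j<K. c (Suc j) * cos (pi * real (Suc j) * y)) R sequentially"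
    unfolding R_def by (rule Weierstrass_m_test[OF _ M2]) (use c_bound in \<open>auto simp del: of_nat_Suc power_Suc\<close>)
  have contP: "continuous_on {0..2} P"
    by (rule uniform_limit_theorem[OF _ uP]) (auto simp: gauss_pair_def intro!: always_eventually continuous_intros)
  have contR: "continuous_on {0..2} R"
    by (rule uniform_limit_theorem[OF _ uR]) (auto intro!: always_eventually continuous_intros)
  have ccos: "continuous_on {0..2} (\<lambda>y. cos (pi * real i * y))" for i
    by (intro continuous_intros)
  have bcos: "bounded ((\<lambda>y. cos (pi * real i * y)) ` {0..2})" for i
    by (intro compact_imp_bounded compact_continuous_image ccos) auto
  have bP: "bounded (P ` {0..2})" "bounded (R ` {0..2})"
    by (intro compact_imp_bounded compact_continuous_image contP contR; simp)+
  have intP: "((\<lambda>y. P y * cos (pi * real i * y)) has_integral c i) {0..2}" for i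
  proof -
    have u: "uniform_limit {0..2} (\<lambda>K y. (\<Sum>k<K. gauss_pair a k y) * cos (pi * real i * y)) 
          (\<lambda>y. P y * cos (pi * real i * y)) sequentially"
      by (rule uniform_lim_mult[OF uP uniform_limit_const bP(1) bcos])
    obtain I J where I: "\<And>K. ((\<lambda>y. (\<Sum>k<K. gauss_pair a k y) * cos (pi * real i * y)) has_integral I K) {0..2}"
      and J: "((\<lambda>y. P y * cos (pi * real i * y)) has_integral J) {0..2}" "I \<longlonglongrightarrow> J"
      by (rule uniform_limit_integral[OF u]) (auto simp: gauss_pair_def intro!: continuous_intros)
    have "I = (\<lambda>K. integral {- real (2 * K)..real (2 * K)} (\<lambda>x. exp (- a * x\<^sup>2) * cos (pi * real i * x)))"
      using has_integral_unique[OF I integral_gauss_pair_sum] by blast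
    then have "I \<longlonglongrightarrow> c i" using integral_gauss_cos_lim[OF a, of "pi * real i"] by (simp add: c_def)
    then show ?thesis using J LIMSEQ_unique by blast
  qed
  have intR: "((\<lambda>y. R y * cos (pi * real i * y)) has_integral (if i = 0 then 0 else c i)) {0..2}" for i
  proof -
    have u: "uniform_limit {0..2} (\<lambda>K y. (\<Sum>j<K. c (Suc j) * cos (pi * real (Suc j) * y)) * cos (pi * real i * y)) 
          (\<lambda>y. R y * cos (pi * real i * y)) sequentially"
      by (rule uniform_lim_mult[OF uR uniform_limit_const bP(2) bcos])
    obtain I J where I: "\<And>K. ((\<lambda>y. (\<Sum>j<K. c (Suc j) * cos (pi * real (Suc j) * y)) * cos (pi * real i * y)) has_integral I K) {0..2}"
      and J: "((\<lambda>y. R y * cos (pi * real i * y)) has_integral J) {0..2}" "I \<longlonglongrightarrow> J"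
      by (rule uniform_limit_integral[OF u]) (auto intro!: continuous_intros)
    have IK: "I K = (\<Sum>j<K. c (Suc j) * (if i = Suc j then 1 else 0))" for K
    proof (rule has_integral_unique[OF I])
      have "((\<lambda>y. \<Sum>j<K. c (Suc j) * (cos (pi * real (Suc j) * y) * cos (pi * real i * y))) has_integral
          (\<Sum>j<K. c (Suc j) * (if i = Suc j then 1 else 0))) {0..2}"
        by (intro has_integral_sum has_integral_mult_right integral_cos_cos_pi) auto
      then show "((\<lambda>y. (\<Sum>j<K. c (Suc j) * cos (pi * real (Suc j) * y)) * cos (pi * real i * y)) has_integral
          (\<Sum>j<K. c (Suc j) * (if i = Suc j then 1 else 0))) {0..2}"
        by (simp add: sum_distrib_right mult.assoc)
    qed
    have "I K = (if i = 0 then 0 else c i)" if "K \<ge> i" for K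
    proof (cases i)
      case 0
      then show ?thesis by (simp add: IK)
    next
      case (Suc m)
      then have "I K = (\<Sum>j<K. if j = m then c (Suc j) else 0)"
        unfolding IK by (intro sum.cong) auto
      also have "\<dots> = c (Suc m)" using that Suc by simp
      finally show ?thesis using Suc by simp
    qed
    then have "I \<longlonglongrightarrow> (if i = 0 then 0 else c i)"
      by (intro tendsto_eventually) (auto simp: eventually_sequentially intro!: exI[of _ i])
    then show ?thesis using J LIMSEQ_unique by blast
  qed
  define D where "D = (\<lambda>y. P y - (c 0 / 2 + R y))"
  have "D x = 0"
  proof (rule fourier_cos_unique[OF _ _ _ x])
    show "continuous_on {0..2} D" unfolding D_def by (intro continuous_intros contP contR)
    show "D (2 - y) = D y" if "y \<in> {0..2}" for y
    proof -
      have "gauss_pair a k (2 - y) = gauss_pair a k y" for k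
        unfolding gauss_pair_def by (simp add: power2_eq_square algebra_simps)
      moreover have "cos (pi * real j * (2 - y)) = cos (pi * real j * y)" for j
        using cos.plus_of_nat[of "- (pi * real j * y)" j] by (simp add: algebra_simps)
      ultimately show ?thesis unfolding D_def P_def R_def by (simp only:)
    qed
    fix i
    have "((\<lambda>y. c 0 / 2 * cos (pi * real i * y)) has_integral (if i = 0 then c 0 else 0)) {0..2}"
    proof (cases "i = 0")
      case True
      then show ?thesis using has_integral_const_real[of "c 0 / 2" 0 2] by simp
    next
      case False
      then show ?thesis using has_integral_mult_right[OF integral_cos_pi[of "int i"], of "c 0 / 2"] by simp
    qed
    from has_integral_diff[OF intP has_integral_add[OF this intR]]
    have "((\<lambda>y. P y * cos (pi * real i * y) - (c 0 / 2 * cos (pi * real i * y) + R y * cos (pi * real i * y)))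
        has_integral 0) {0..2}"
      by (rule has_integral_eq_rhs) auto
    then have "((\<lambda>y. D y * cos (pi * real i * y)) has_integral 0) {0..2}"
      by (simp add: D_def algebra_simps)
    then show "integral {0..2} (\<lambda>y. D y * cos (pi * real i * y)) = 0" by (rule integral_unique)
  qed
  then show "(\<Sum>k. gauss_pair a k x) = c 0 / 2 + (\<Sum>j. c (Suc j) * cos (pi * real (Suc j) * x))"
    by (simp add: D_def P_def R_def)
qed

text \<open>Subtracting the Poisson formulas at \<open>1/4\<close> and \<open>5/4\<close> leaves on the left the blocks of four
of \<open>theta 0 l\<close>, and on the right only the odd frequencies, weighted by \<open>2 cos ((2 m + 1) \<pi> / 4)\<close>,
which is \<open>\<surd>2 chi m\<close>: the series \<open>theta 0 (2 / l)\<close>.\<close>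

lemma theta0_functional:
  assumes l: "l > 0"
  shows "theta 0 (2 / l) = l / sqrt 2 * theta 0 l"
proof -
  define a where "a = pi * l\<^sup>2"
  have a: "a > 0" using l by (simp add: a_def)
  define c where "c = (\<lambda>j::nat. sqrt (pi / a) * exp (- (pi * real j)\<^sup>2 / (4 * a)))"
  have P: "(\<lambda>k. gauss_pair a k x) sums (\<Sum>k. gauss_pair a k x)"
      "summable (\<lambda>j. c (Suc j) * cos (pi * real (Suc j) * x))"
      "(\<Sum>k. gauss_pair a k x) = c 0 / 2 + (\<Sum>j. c (Suc j) * cos (pi * real (Suc j) * x))"
    if "x \<in> {0..2}" for x
    unfolding c_def by (rule gauss_poisson[OF a that])+
  define f where "f = (\<lambda>m. chi m * psi 0 (l * (2 * real m + 1) / 4))"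
  have sf: "f sums theta 0 l" unfolding f_def theta_def by (rule summable_sums[OF summable_theta[OF l]])
  have left: "(\<lambda>k. gauss_pair a k (1/4) - gauss_pair a k (5/4)) sums theta 0 l"
  proof -
    have "sum f {k * 4..<k * 4 + 4} = gauss_pair a k (1/4) - gauss_pair a k (5/4)" for k
    proof -
      have "{k * 4..<k * 4 + 4} = {4 * k, 4 * k + 1, 4 * k + 2, 4 * k + 3}" by auto
      then have "sum f {k * 4..<k * 4 + 4} = f (4 * k) + f (4 * k + 1) + f (4 * k + 2) + f (4 * k + 3)"
        by (simp add: eval_nat_numeral)
      also have "\<dots> = psi 0 (l * (2 * real (4 * k) + 1) / 4) - psi 0 (l * (2 * real (4 * k + 1) + 1) / 4) - 
          psi 0 (l * (2 * real (4 * k + 2) + 1) / 4) + psi 0 (l * (2 * real (4 * k + 3) + 1) / 4)"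
      proof -
        have "Suc (4 * k) div 2 = 2 * k" "Suc (4 * k + 1) div 2 = 2 * k + 1" "Suc (4 * k + 2) div 2 = 2 * k + 1" 
          "Suc (4 * k + 3) div 2 = 2 * k + 2" by presburger+
        then show ?thesis unfolding f_def chi_def by simp
      qed
      also have "psi 0 (l * (2 * real (4 * k) + 1) / 4) = exp (- a * (1/4 + 2 * real k)\<^sup>2)"
        by (simp add: psi_def a_def power2_eq_square field_simps)
      also have "psi 0 (l * (2 * real (4 * k + 1) + 1) / 4) = exp (- a * (5/4 - 2 - 2 * real k)\<^sup>2)"
        by (simp add: psi_def a_def power2_eq_square field_simps)
      also have "psi 0 (l * (2 * real (4 * k + 2) + 1) / 4) = exp (- a * (5/4 + 2 * real k)\<^sup>2)"
        by (simp add: psi_def a_def power2_eq_square field_simps)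
      also have "psi 0 (l * (2 * real (4 * k + 3) + 1) / 4) = exp (- a * (1/4 - 2 - 2 * real k)\<^sup>2)"
        by (simp add: psi_def a_def power2_eq_square field_simps)
      finally show ?thesis by (simp add: gauss_pair_def)
    qed
    then show ?thesis using sums_group[OF sf, of 4] by simp
  qed
  define g where "g = (\<lambda>j. c (Suc j) * cos (pi * real (Suc j) * (1/4)) - c (Suc j) * cos (pi * real (Suc j) * (5/4)))"
  have "theta 0 l = (\<Sum>k. gauss_pair a k (1/4)) - (\<Sum>k. gauss_pair a k (5/4))"
    by (rule sums_unique2[OF left sums_diff[OF P(1) P(1)]]) auto
  also have "\<dots> = (c 0 / 2 + (\<Sum>j. c (Suc j) * cos (pi * real (Suc j) * (1/4)))) - 
      (c 0 / 2 + (\<Sum>j. c (Suc j) * cos (pi * real (Suc j) * (5/4))))"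
    using P(3)[of "1/4"] P(3)[of "5/4"] by simp
  also have "\<dots> = (\<Sum>j. c (Suc j) * cos (pi * real (Suc j) * (1/4))) - 
      (\<Sum>j. c (Suc j) * cos (pi * real (Suc j) * (5/4)))" by (simp only: add_diff_cancel_left)
  also have "\<dots> = (\<Sum>j. g j)"
    unfolding g_def by (rule suminf_diff[OF P(2) P(2)]) auto
  finally have th: "theta 0 l = (\<Sum>j. g j)" .
  have "summable g" unfolding g_def by (intro summable_diff P(2)) auto
  then have "g sums theta 0 l" unfolding th by (rule summable_sums)
  then have "(\<lambda>m. sum g {m * 2..<m * 2 + 2}) sums theta 0 l" by (rule sums_group) simp
  moreover have "sum g {m * 2..<m * 2 + 2} = sqrt 2 / l * (chi m * psi 0 (2 / l * (2 * real m + 1) / 4))" for m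
  proof -
    have "{m * 2..<m * 2 + 2} = {2 * m, Suc (2 * m)}" by auto
    then have *: "sum g {m * 2..<m * 2 + 2} = g (2 * m) + g (Suc (2 * m))" by simp
    have c5: "cos (pi * real j * (5/4)) = (- 1) ^ j * cos (pi * real j * (1/4))" for j
    proof -
      have "pi * real j * (5/4) = pi * real j * (1/4) + real j * pi" by (simp add: algebra_simps)
      then show ?thesis by (simp only: cos_add cos_npi sin_npi) simp
    qed
    have "sum g {m * 2..<m * 2 + 2} = 2 * c (2 * m + 1) * cos (pi * real (2 * m + 1) * (1/4))"
      unfolding * g_def c5 by (simp add: mult.commute[of m 2] del: of_nat_Suc)
    also have "cos (pi * real (2 * m + 1) * (1/4)) = chi m * (sqrt 2 / 2)"
    proof -
      have c4: "cos (real k * pi + pi / 4) = (- 1) ^ k * (sqrt 2 / 2)" 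
           "cos (real k * pi - pi / 4) = (- 1) ^ k * (sqrt 2 / 2)" for k
        by (simp_all add: cos_add cos_diff cos_45)
      show ?thesis
      proof (cases "even m")
        case True
        then obtain k where k: "m = 2 * k" by blast
        have "pi * real (2 * m + 1) * (1/4) = real k * pi + pi / 4" by (simp add: k field_simps)
        moreover have "Suc m div 2 = k" by (simp add: k)
        ultimately show ?thesis unfolding chi_def by (simp only: c4)
      next
        case False
        then obtain k where k: "m = 2 * k + 1" using oddE by blast
        have "pi * real (2 * m + 1) * (1/4) = real (k + 1) * pi - pi / 4" by (simp add: k field_simps)
        moreover have "Suc m div 2 = k + 1" by (simp add: k)
        ultimately show ?thesis unfolding chi_def by (simp only: c4)
      qed
    qed
    also have "c (2 * m + 1) = 1 / l * psi 0 (2 / l * (2 * real m + 1) / 4)"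
    proof -
      have "sqrt (pi / a) = 1 / l" using l by (simp add: a_def real_sqrt_divide)
      moreover have "- (pi * real (2 * m + 1))\<^sup>2 / (4 * a) = - pi * (2 / l * (2 * real m + 1) / 4)\<^sup>2"
        using l by (simp add: a_def power2_eq_square field_simps)
      ultimately show ?thesis unfolding c_def psi_def by simp
    qed
    finally show ?thesis by (simp add: algebra_simps)
  qed
  ultimately have "(\<lambda>m. sqrt 2 / l * (chi m * psi 0 (2 / l * (2 * real m + 1) / 4))) sums theta 0 l" by simp
  moreover have "(\<lambda>m. sqrt 2 / l * (chi m * psi 0 (2 / l * (2 * real m + 1) / 4))) sums (sqrt 2 / l * theta 0 (2 / l))"
    unfolding theta_def using l by (intro sums_mult summable_sums summable_theta) simp
  ultimately have "theta 0 l = sqrt 2 / l * theta 0 (2 / l)" by (rule sums_unique2)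
  then show ?thesis using l by (simp add: field_simps)
qed

section \<open>Bessel's inequality for exponentials\<close>

lemma integral_cis_period:
  fixes l :: real and j :: int
  assumes l: "l > 0" and j: "j \<noteq> 0"
  shows "((\<lambda>x. cis (2 * pi * of_int j * x / l)) has_integral 0) {a..a + l}"
proof -
  define w where "w = 2 * pi * of_int j / l"
  have w: "w \<noteq> 0" using l j by (simp add: w_def)
  have "((\<lambda>x. cis (w * x)) has_integral (cis (w * (a + l)) / (\<i> * w) - cis (w * a) / (\<i> * w))) {a..a + l}"
  proof (rule fundamental_theorem_of_calculus)
    fix x
    have "((\<lambda>z. exp (\<i> * w * z) / (\<i> * w)) has_field_derivative exp (\<i> * w * complex_of_real x)) (at (complex_of_real x))"
      using w by (auto intro!: derivative_eq_intros)
    then have "((\<lambda>x. exp (\<i> * w * complex_of_real x) / (\<i> * w)) has_vector_derivative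
        exp (\<i> * w * complex_of_real x)) (at x within {a..a + l})"
      by (rule has_vector_derivative_real_field)
    then show "((\<lambda>x. cis (w * x) / (\<i> * w)) has_vector_derivative cis (w * x)) (at x within {a..a + l})"
      by (simp add: cis_conv_exp mult.assoc)
  qed (use l in simp)
  moreover have "cis (w * (a + l)) = cis (w * a)"
  proof -
    have "w * (a + l) = w * a + 2 * pi * of_int j" using l by (simp add: w_def field_simps)
    moreover have "cis (2 * pi * of_int j) = 1" by (rule cis_multiple_2pi) auto
    ultimately show ?thesis by (simp flip: cis_mult)
  qed
  ultimately show ?thesis by (simp add: w_def mult_ac)
qed

text \<open>The exponentials are orthogonal on a full period, which may be longer than the interval
that carries \<open>u\<close>; the integral of the nonnegative \<open>\<bar>T\<bar>\<^sup>2\<close> only grows when passing to the full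
period.\<close>

lemma bessel_inequality:
  fixes u :: "real \<Rightarrow> complex" and M :: "int set"
  assumes l: "l > 0" and ab: "b \<le> a + l" and u: "continuous_on {a..b} u" and M: "finite M"
  shows "(\<Sum>m\<in>M. (norm (integral {a..b} (\<lambda>x. u x * cnj (cis (2 * pi * of_int m * x / l)))))\<^sup>2)
     \<le> l * integral {a..b} (\<lambda>x. (norm (u x))\<^sup>2)"
proof -
  define e where "e = (\<lambda>(m::int) x. cis (2 * pi * of_int m * x / l))"
  have ce: "continuous_on A (e m)" for A m unfolding e_def by (intro continuous_intros) (use l in auto)
  define c where "c = (\<lambda>m. integral {a..b} (\<lambda>x. u x * cnj (e m x)))"
  define Q where "Q = (\<Sum>m\<in>M. (norm (c m))\<^sup>2)"
  define T where "T = (\<lambda>x. \<Sum>m\<in>M. c m * e m x)"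
  have cT: "continuous_on A T" for A unfolding T_def by (intro continuous_intros ce)
  have "((\<lambda>x. \<Sum>m\<in>M. cnj (c m) * (u x * cnj (e m x))) has_integral (\<Sum>m\<in>M. cnj (c m) * c m)) {a..b}"
    unfolding c_def
    by (intro has_integral_sum M has_integral_mult_right integrable_integral integrable_continuous_real continuous_intros u ce)
  also have "(\<lambda>x. \<Sum>m\<in>M. cnj (c m) * (u x * cnj (e m x))) = (\<lambda>x. u x * cnj (T x))"
    by (simp add: T_def sum_distrib_left mult_ac)
  also have "(\<Sum>m\<in>M. cnj (c m) * c m) = of_real Q"
    unfolding Q_def of_real_sum complex_norm_square by (simp add: mult.commute)
  finally have uT: "((\<lambda>x. Re (u x * cnj (T x))) has_integral Q) {a..b}"
    by (drule_tac has_integral_linear[OF _ bounded_linear_Re]) (simp only: o_def Re_complex_of_real)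
  have "((\<lambda>x. e m x * cnj (e k x)) has_integral (if k = m then of_real l else 0)) {a..a + l}" for m k
  proof -
    have eq: "e m x * cnj (e k x) = cis (2 * pi * of_int (m - k) * x / l)" for x
      unfolding e_def cis_cnj cis_mult by (simp add: algebra_simps diff_divide_distrib)
    show ?thesis
    proof (cases "k = m")
      case True
      then show ?thesis unfolding eq using has_integral_const_real[of "1::complex" a "a + l"] l 
        by (simp add: scaleR_conv_of_real)
    next
      case False
      then show ?thesis unfolding eq using integral_cis_period[OF l, of "m - k" a] by simp
    qed
  qed
  then have "((\<lambda>x. \<Sum>m\<in>M. \<Sum>k\<in>M. (c m * cnj (c k)) * (e m x * cnj (e k x))) has_integral
      (\<Sum>m\<in>M. \<Sum>k\<in>M. (c m * cnj (c k)) * (if k = m then of_real l else 0))) {a..a + l}"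
    by (intro has_integral_sum M has_integral_mult_right)
  also have "(\<lambda>x. \<Sum>m\<in>M. \<Sum>k\<in>M. (c m * cnj (c k)) * (e m x * cnj (e k x))) = (\<lambda>x. complex_of_real ((norm (T x))\<^sup>2))"
    unfolding complex_norm_square T_def by (simp add: sum_product mult_ac)
  also have "(\<Sum>m\<in>M. \<Sum>k\<in>M. (c m * cnj (c k)) * (if k = m then of_real l else 0)) = of_real (l * Q)"
  proof -
    have "(\<Sum>k\<in>M. (c m * cnj (c k)) * (if k = m then of_real l else 0)) = of_real (l * (norm (c m))\<^sup>2)" if "m \<in> M" for m
    proof -
      have "(\<Sum>k\<in>M. (c m * cnj (c k)) * (if k = m then of_real l else 0)) = (\<Sum>k\<in>M. if k = m then c m * cnj (c m) * of_real l else 0)"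
        by (intro sum.cong) auto
      also have "\<dots> = c m * cnj (c m) * of_real l" using that M by simp
      finally show ?thesis unfolding of_real_mult complex_norm_square by (simp add: mult_ac)
    qed
    then show ?thesis by (simp add: Q_def sum_distrib_left)
  qed
  finally have TT: "((\<lambda>x. (norm (T x))\<^sup>2) has_integral l * Q) {a..a + l}"
    by (drule_tac has_integral_linear[OF _ bounded_linear_Re]) (simp only: o_def Re_complex_of_real)
  have cont2: "continuous_on A (\<lambda>x. (norm (T x))\<^sup>2)" for A by (intro continuous_intros cT)
  have TT': "integral {a..b} (\<lambda>x. (norm (T x))\<^sup>2) \<le> l * Q"
    unfolding integral_unique[OF TT, symmetric]
    by (rule integral_subset_le) (use ab in \<open>auto intro!: integrable_continuous_real cont2\<close>)
  have ptw: "(norm (u x - T x / of_real l))\<^sup>2 = (norm (u x))\<^sup>2 - 2 / l * Re (u x * cnj (T x)) + (norm (T x))\<^sup>2 / l\<^sup>2" for x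
  proof -
    have "complex_of_real ((norm (u x - T x / of_real l))\<^sup>2) = 
       u x * cnj (u x) - (u x * cnj (T x) + cnj (u x * cnj (T x))) / of_real l + T x * cnj (T x) / of_real (l\<^sup>2)"
      unfolding complex_norm_square using l by (simp add: field_simps power2_eq_square)
    also have "\<dots> = complex_of_real ((norm (u x))\<^sup>2 - 2 / l * Re (u x * cnj (T x)) + (norm (T x))\<^sup>2 / l\<^sup>2)"
      unfolding complex_add_cnj of_real_add of_real_diff of_real_divide complex_norm_square by simp
    finally show ?thesis by (simp only: of_real_eq_iff)
  qed
  have cu: "continuous_on {a..b} (\<lambda>x. (norm (u x))\<^sup>2)" by (intro continuous_intros u)
  have "((\<lambda>x. (norm (u x - T x / of_real l))\<^sup>2) has_integral
      integral {a..b} (\<lambda>x. (norm (u x))\<^sup>2) - 2 / l * Q + integral {a..b} (\<lambda>x. (norm (T x))\<^sup>2) / l\<^sup>2) {a..b}"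
    unfolding ptw
    by (intro has_integral_add has_integral_diff has_integral_mult_right has_integral_divide uT 
         integrable_integral integrable_continuous_real cu cont2)
  then have "0 \<le> integral {a..b} (\<lambda>x. (norm (u x))\<^sup>2) - 2 / l * Q + integral {a..b} (\<lambda>x. (norm (T x))\<^sup>2) / l\<^sup>2"
    by (rule has_integral_nonneg) auto
  also have "\<dots> \<le> integral {a..b} (\<lambda>x. (norm (u x))\<^sup>2) - 2 / l * Q + l * Q / l\<^sup>2"
    using TT' by (intro add_left_mono divide_right_mono) auto
  also have "\<dots> = integral {a..b} (\<lambda>x. (norm (u x))\<^sup>2) - Q / l"
    using l by (simp add: power2_eq_square field_simps)
  finally have "Q \<le> l * integral {a..b} (\<lambda>x. (norm (u x))\<^sup>2)" using l by (simp add: field_simps)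
  then show ?thesis by (simp add: Q_def c_def e_def)
qed

section \<open>Alternating sums over a lattice\<close>

lemma summable_exp_int:
  assumes "l > 0"
  shows "(\<lambda>k::int. exp (- l * \<bar>of_int k\<bar>) :: real) summable_on UNIV"
proof -
  have g: "(\<lambda>n::nat. exp (- l * real n)) summable_on UNIV"
  proof (subst summable_on_UNIV_nonneg_real_iff)
    have "(\<lambda>n::nat. exp (- l * real n)) = (\<lambda>n. exp (- l) ^ n)"
      by (simp add: fun_eq_iff mult.commute flip: exp_of_nat_mult)
    then show "summable (\<lambda>n::nat. exp (- l * real n))" using assms by (simp add: summable_geometric)
  qed auto
  have 1: "(\<lambda>k::int. exp (- l * \<bar>of_int k\<bar>) :: real) summable_on (range int)"
    by (subst summable_on_reindex) (use g in \<open>auto simp: o_def\<close>)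
  have 2: "(\<lambda>k::int. exp (- l * \<bar>of_int k\<bar>) :: real) summable_on ((\<lambda>n. - int n) ` {1..})"
    by (subst summable_on_reindex)
       (use summable_on_subset_banach[OF g, of "{1..}"] in \<open>auto simp: o_def inj_on_def\<close>)
  have 3: "(UNIV :: int set) = range int \<union> (\<lambda>n. - int n) ` {1..}"
  proof -
    have "k \<in> range int \<union> (\<lambda>n. - int n) ` {1..}" for k
    proof (cases "k \<ge> 0")
      case True
      then show ?thesis by (metis UnI1 nat_0_le rangeI)
    next
      case False
      then have "k = - int (nat (- k))" "nat (- k) \<in> {1..}" by auto
      then show ?thesis by blast
    qed
    then show ?thesis by blast
  qed
  show ?thesis
    unfolding 3 by (rule summable_on_Un_disjoint[OF 1 2]) auto
qed

definition alt_sign :: "int \<Rightarrow> complex" where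
  "alt_sign k = (if even k then 1 else - 1)"

lemma norm_alt_sign [simp]: "norm (alt_sign k) = 1" by (simp add: alt_sign_def)
lemma alt_sign_add: "alt_sign (j + k) = alt_sign j * alt_sign k" by (auto simp: alt_sign_def)

text \<open>Up to scaling this is the Zak transform at \<open>\<gamma> = 1/2\<close>, as a function of the unscaled
argument \<open>y = l x\<close>.\<close>

definition altsum :: "real \<Rightarrow> (real \<Rightarrow> complex) \<Rightarrow> real \<Rightarrow> complex" where
  "altsum l g y = (\<Sum>\<^sub>\<infinity>k\<in>(UNIV :: int set). alt_sign k * g (y + l * of_int k))"

lemma altsum_shift:
  "norm (altsum l g (y + l * of_int j)) = norm (altsum l g y)"
proof -
  have "altsum l g y = (\<Sum>\<^sub>\<infinity>k. alt_sign (k + j) * g (y + l * of_int (k + j)))"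
    unfolding altsum_def
    by (rule infsum_reindex_bij_betw[symmetric, of "\<lambda>k. k + j" UNIV UNIV])
       (rule bij_betw_byWitness[where f' = "\<lambda>k. k - j"], auto)
  also have "\<dots> = (\<Sum>\<^sub>\<infinity>k. alt_sign j * (alt_sign k * g (y + l * of_int j + l * of_int k)))"
    by (rule infsum_cong) (simp add: alt_sign_add algebra_simps)
  also have "\<dots> = alt_sign j * altsum l g (y + l * of_int j)"
    unfolding altsum_def by (rule infsum_cmult_right') 
  finally show ?thesis by (simp add: norm_mult)
qed

lemma shifted_decay_bound:
  fixes g :: "real \<Rightarrow> complex"
  assumes g: "\<And>y. norm (g y) \<le> C * exp (- \<bar>y\<bar>)" and "C > 0" "l > 0" "\<bar>x\<bar> \<le> R"
  shows "norm (g (x + l * t)) \<le> C * exp R * exp (- l * \<bar>t\<bar>)"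
proof -
  have "\<bar>l * t\<bar> \<le> \<bar>x + l * t\<bar> + \<bar>x\<bar>" by linarith
  then have "l * \<bar>t\<bar> \<le> \<bar>x + l * t\<bar> + R" using assms by (simp add: abs_mult)
  then have "exp (- \<bar>x + l * t\<bar>) \<le> exp (R + (- l * \<bar>t\<bar>))" by simp
  then have "C * exp (- \<bar>x + l * t\<bar>) \<le> C * exp (R + (- l * \<bar>t\<bar>))" using assms by (intro mult_left_mono) auto
  also have "\<dots> = C * exp R * exp (- l * \<bar>t\<bar>)" unfolding exp_add by simp
  finally show ?thesis using g[of "x + l * t"] by (rule order_trans[rotated])
qed

lemma altsum_summable:
  fixes g :: "real \<Rightarrow> complex"
  assumes g: "\<And>y. norm (g y) \<le> C * exp (- \<bar>y\<bar>)" and "C > 0" "l > 0"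
  shows "(\<lambda>k::int. alt_sign k * g (y + l * of_int k)) summable_on UNIV"
proof (rule abs_summable_summable)
  have "(\<lambda>k::int. C * exp \<bar>y\<bar> * exp (- l * \<bar>of_int k\<bar>)) summable_on UNIV"
    by (intro summable_on_cmult_right summable_exp_int assms)
  then show "(\<lambda>k::int. norm (alt_sign k * g (y + l * of_int k))) summable_on UNIV"
    by (rule summable_on_comparison_test)
       (use shifted_decay_bound[OF assms order_refl] in \<open>auto simp: norm_mult\<close>)
qed

lemma continuous_on_altsum:
  fixes g :: "real \<Rightarrow> complex"
  assumes cont: "continuous_on UNIV g" 
    and g: "\<And>y. norm (g y) \<le> C * exp (- \<bar>y\<bar>)" and "C > 0" "l > 0"
  shows "continuous_on {-R..R} (altsum l g)"
proof -
  have "uniform_limit {-R..R} (\<lambda>X y. \<Sum>k\<in>X. alt_sign k * g (y + l * of_int k)) 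
      (\<lambda>y. \<Sum>\<^sub>\<infinity>k\<in>UNIV. alt_sign k * g (y + l * of_int k)) (finite_subsets_at_top UNIV)"
  proof (rule Weierstrass_m_test_general)
    show "(\<lambda>k::int. C * exp R * exp (- l * \<bar>of_int k\<bar>)) summable_on UNIV"
      by (intro summable_on_cmult_right summable_exp_int assms)
    show "norm (alt_sign k * g (y + l * of_int k)) \<le> C * exp R * exp (- l * \<bar>of_int k\<bar>)"
      if "y \<in> {-R..R}" for k y
      using shifted_decay_bound[OF g \<open>C > 0\<close> \<open>l > 0\<close>, of y R "of_int k"] that by (auto simp: norm_mult)
  qed
  moreover have "continuous_on {-R..R} (\<lambda>y. \<Sum>k\<in>X. alt_sign k * g (y + l * of_int k))" for X
    by (intro continuous_intros continuous_on_compose2[OF cont]) auto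
  ultimately have "continuous_on {-R..R} (\<lambda>y. \<Sum>\<^sub>\<infinity>k\<in>UNIV. alt_sign k * g (y + l * of_int k))"
    by (intro uniform_limit_theorem[where F = "finite_subsets_at_top UNIV"]) auto
  then show ?thesis by (simp add: altsum_def[abs_def])
qed

lemma infsum_exp_int_shift:
  "(\<lambda>j::int. exp (- l * \<bar>of_int (j + i)\<bar>) :: real) summable_on UNIV \<longleftrightarrow> (\<lambda>j::int. exp (- l * \<bar>of_int j\<bar>) :: real) summable_on UNIV"
  "(\<Sum>\<^sub>\<infinity>j::int. exp (- l * \<bar>of_int (j + i)\<bar>) :: real) = (\<Sum>\<^sub>\<infinity>j::int. exp (- l * \<bar>of_int j\<bar>))"
proof -
  have b: "bij_betw (\<lambda>j::int. j + i) UNIV UNIV"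
    by (rule bij_betw_byWitness[where f' = "\<lambda>k. k - i"]) auto
  show "(\<lambda>j::int. exp (- l * \<bar>of_int (j + i)\<bar>) :: real) summable_on UNIV \<longleftrightarrow> (\<lambda>j::int. exp (- l * \<bar>of_int j\<bar>) :: real) summable_on UNIV"
    by (rule summable_on_reindex_bij_betw[OF b])
  show "(\<Sum>\<^sub>\<infinity>j::int. exp (- l * \<bar>of_int (j + i)\<bar>) :: real) = (\<Sum>\<^sub>\<infinity>j::int. exp (- l * \<bar>of_int j\<bar>))"
    by (rule infsum_reindex_bij_betw[OF b])
qed

text \<open>The window \<open>[-N, N]\<close> seen from position \<open>k / 2\<close>. If \<open>k / 2\<close> lies inside, the truncated sum is the full
sum minus tails; if it lies outside, the truncated sum consists of tails only. In
both cases the error decays exponentially with the distance of \<open>k / 2\<close> from the nearer end of the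
window, so its total over \<open>k\<close> does not depend on \<open>N\<close>.\<close>

lemma truncated_altsum_bound:
  fixes g :: "real \<Rightarrow> complex" and N k :: int
  assumes g: "\<And>y. norm (g y) \<le> C * exp (- \<bar>y\<bar>)" and C: "C > 0" and l: "l > 0" and x: "\<bar>x\<bar> \<le> R"
  defines "S \<equiv> (\<Sum>\<^sub>\<infinity>i::int. exp (- l * \<bar>of_int i\<bar>) :: real)"
  shows "norm (\<Sum>j\<in>{-N..N}. alt_sign j * g (x + l * (of_int j - of_int k / 2))) \<le>
     (if \<bar>k\<bar> \<le> 2 * N then norm (altsum l g (x - l * of_int k / 2)) else 0) +
     C * exp R * S * (exp (- l / 2 * \<bar>of_int (k - 2 * N)\<bar>) + exp (- l / 2 * \<bar>of_int (k + 2 * N)\<bar>))"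
proof -
  define t where "t = (\<lambda>j. alt_sign j * g (x + l * (of_int j - of_int k / 2)))"
  define P where "P = exp (- l / 2 * \<bar>real_of_int (k - 2 * N)\<bar>)"
  define M where "M = exp (- l / 2 * \<bar>real_of_int (k + 2 * N)\<bar>)"
  define B where "B = (\<lambda>j::int. C * exp R * (P * exp (- l * \<bar>of_int (j + - N)\<bar>) + M * exp (- l * \<bar>of_int (j + N)\<bar>)))"
  have B0: "B j \<ge> 0" for j using C by (simp add: B_def P_def M_def)
  have hs: "((\<lambda>j::int. exp (- l * \<bar>of_int (j + i)\<bar>)) has_sum S) UNIV" for i
    using has_sum_infsum[OF infsum_exp_int_shift(1)[THEN iffD2, OF summable_exp_int[OF l]], of i]
    unfolding infsum_exp_int_shift(2) S_def .
  have "((\<lambda>j::int. P * exp (- l * \<bar>of_int (j + - N)\<bar>) + M * exp (- l * \<bar>of_int (j + N)\<bar>)) has_sum (P * S + M * S)) UNIV"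
    by (intro has_sum_add has_sum_cmult_right hs)
  then have "(B has_sum (C * exp R * (P * S + M * S))) UNIV"
    unfolding B_def by (rule has_sum_cmult_right)
  then have sB: "B summable_on UNIV" "infsum B UNIV = C * exp R * S * (P + M)"
    by (auto simp: has_sum_iff algebra_simps)
  have t_le: "norm (t j) \<le> B j" if "(\<bar>k\<bar> \<le> 2 * N) \<noteq> (j \<in> {-N..N})" for j
  proof -
    have k: "of_int j - of_int k / (2::real) = real_of_int (2 * j - k) / 2" by simp
    have "norm (t j) \<le> C * exp R * exp (- l * \<bar>of_int j - of_int k / 2\<bar>)"
      unfolding t_def norm_mult norm_alt_sign mult_1 by (rule shifted_decay_bound[OF g C l x])
    also have "exp (- l * \<bar>of_int j - of_int k / 2\<bar>) \<le> P * exp (- l * \<bar>of_int (j + - N)\<bar>) + M * exp (- l * \<bar>of_int (j + N)\<bar>)"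
    proof -
      \<comment> \<open>an end of the window separates \<open>j\<close> from \<open>k / 2\<close>, so the distance splits there\<close>
      have "\<bar>2 * j - k\<bar> = \<bar>k - 2 * N\<bar> + 2 * \<bar>j + - N\<bar> \<or> \<bar>2 * j - k\<bar> = \<bar>k + 2 * N\<bar> + 2 * \<bar>j + N\<bar>"
        using that by auto
      then have disj: "exp (- l * (real_of_int \<bar>2 * j - k\<bar> / 2)) = P * exp (- l * \<bar>of_int (j + - N)\<bar>) \<or>
          exp (- l * (real_of_int \<bar>2 * j - k\<bar> / 2)) = M * exp (- l * \<bar>of_int (j + N)\<bar>)"
      proof (elim disjE)
        assume h: "\<bar>2 * j - k\<bar> = \<bar>k - 2 * N\<bar> + 2 * \<bar>j + - N\<bar>"
        show ?thesis unfolding h P_def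
          by (rule disjI1) (simp add: field_simps flip: exp_add)
      next
        assume h: "\<bar>2 * j - k\<bar> = \<bar>k + 2 * N\<bar> + 2 * \<bar>j + N\<bar>"
        show ?thesis unfolding h M_def
          by (rule disjI2) (simp add: field_simps flip: exp_add)
      qed
      have nonneg: "P * exp (- l * \<bar>of_int (j + - N)\<bar>) \<ge> 0" "M * exp (- l * \<bar>of_int (j + N)\<bar>) \<ge> 0"
        by (simp_all add: P_def M_def)
      have e: "\<bar>of_int j - of_int k / (2::real)\<bar> = real_of_int \<bar>2 * j - k\<bar> / 2"
        unfolding k by simp
      from disj show ?thesis unfolding e by (rule disjE) (use nonneg in linarith)+
    qed
    finally show ?thesis using C by (simp add: B_def)
  qed
  have "norm (sum t {-N..N}) \<le> (if \<bar>k\<bar> \<le> 2 * N then norm (altsum l g (x - l * of_int k / 2)) else 0) + infsum B UNIV"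
  proof (cases "\<bar>k\<bar> \<le> 2 * N")
    case True
    have ts: "t summable_on UNIV" and tv: "infsum t UNIV = altsum l g (x - l * of_int k / 2)"
      using altsum_summable[OF g C l, of "x - l * of_int k / 2"]
      by (simp_all add: t_def altsum_def algebra_simps)
    have ts': "t summable_on (- {-N..N})" using summable_on_subset_banach[OF ts] by blast
    have "infsum t ({-N..N} \<union> - {-N..N}) = infsum t {-N..N} + infsum t (- {-N..N})"
      by (intro infsum_Un_disjoint ts') auto
    then have eq: "sum t {-N..N} = altsum l g (x - l * of_int k / 2) - infsum t (- {-N..N})"
      using tv by (simp only: Compl_partition infsum_finite finite_atLeastAtMost_int) (simp add: algebra_simps)
    have sB': "B summable_on (- {-N..N})" using summable_on_subset_banach[OF sB(1)] by blast
    have "norm (infsum t (- {-N..N})) \<le> infsum B (- {-N..N})"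
      by (rule norm_infsum_le[OF has_sum_infsum[OF ts'] has_sum_infsum[OF sB']]) (use t_le True in auto)
    also have "\<dots> \<le> infsum B UNIV"
      by (rule infsum_mono_neutral[OF sB' sB(1)]) (use B0 in auto)
    finally show ?thesis unfolding eq using True
      norm_triangle_ineq4[of "altsum l g (x - l * of_int k / 2)" "infsum t (- {-N..N})"] by simp
  next
    case False
    have "norm (sum t {-N..N}) \<le> sum B {-N..N}"
      by (rule sum_norm_le) (use t_le False in auto)
    also have "\<dots> \<le> infsum B UNIV"
      by (rule finite_sum_le_infsum[OF sB(1)]) (use B0 in auto)
    finally show ?thesis using False by simp
  qed
  then show ?thesis unfolding sB(2) by (simp only: t_def P_def M_def)
qed

lemma sum_truncated_altsum_bound:
  fixes g :: "real \<Rightarrow> complex" and N :: int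
  assumes g: "\<And>y. norm (g y) \<le> C * exp (- \<bar>y\<bar>)" and C: "C > 0" and l: "l > 0" and x: "\<bar>x\<bar> \<le> R"
    and N: "N \<ge> 0" and K: "finite K" and W: "\<And>k::int. norm (altsum l g (x - l * of_int k / 2)) \<le> \<epsilon>"
  defines "S \<equiv> (\<Sum>\<^sub>\<infinity>i::int. exp (- l * \<bar>of_int i\<bar>) :: real)"
  shows "(\<Sum>k\<in>K. (norm (\<Sum>j\<in>{-N..N}. alt_sign j * g (x + l * (of_int j - of_int k / 2))))\<^sup>2) \<le>
     3 * (\<epsilon>\<^sup>2 * (4 * of_int N + 1) + 2 * (C * exp R * S)\<^sup>2 * S)"
proof -
  define P where "P = (\<lambda>k. exp (- l / 2 * \<bar>real_of_int (k - 2 * N)\<bar>))"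
  define M where "M = (\<lambda>k. exp (- l / 2 * \<bar>real_of_int (k + 2 * N)\<bar>))"
  define E where "E = (\<lambda>k. if \<bar>k\<bar> \<le> 2 * N then \<epsilon> else 0)"
  define D where "D = C * exp R * S"
  have \<epsilon>: "\<epsilon> \<ge> 0" using W[of 0] norm_ge_zero order_trans by blast
  have S0: "S \<ge> 0" unfolding S_def by (rule infsum_nonneg) auto
  have sq3: "(p + q + r)\<^sup>2 \<le> 3 * (p\<^sup>2 + q\<^sup>2 + r\<^sup>2)" for p q r :: real
  proof -
    have "0 \<le> (p - q)\<^sup>2 + (q - r)\<^sup>2 + (p - r)\<^sup>2" by simp
    then show ?thesis by (simp add: power2_eq_square algebra_simps)
  qed
  have 1: "(norm (\<Sum>j\<in>{-N..N}. alt_sign j * g (x + l * (of_int j - of_int k / 2))))\<^sup>2 \<le> 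
     3 * ((E k)\<^sup>2 + D\<^sup>2 * (exp (- l * \<bar>of_int (k + - (2 * N))\<bar>) + exp (- l * \<bar>of_int (k + 2 * N)\<bar>)))" for k
  proof -
    have "norm (\<Sum>j\<in>{-N..N}. alt_sign j * g (x + l * (of_int j - of_int k / 2))) \<le> E k + D * (P k + M k)"
    proof -
      have "(if \<bar>k\<bar> \<le> 2 * N then norm (altsum l g (x - l * of_int k / 2)) else 0) \<le> E k"
        using W[of k] by (simp add: E_def)
      then show ?thesis
        using truncated_altsum_bound[OF g C l x, of k N, folded S_def]
        unfolding D_def P_def M_def by linarith
    qed
    then have "(norm (\<Sum>j\<in>{-N..N}. alt_sign j * g (x + l * (of_int j - of_int k / 2))))\<^sup>2 \<le> (E k + D * P k + D * M k)\<^sup>2"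
      by (intro power_mono) (auto simp: algebra_simps)
    also have "\<dots> \<le> 3 * ((E k)\<^sup>2 + (D * P k)\<^sup>2 + (D * M k)\<^sup>2)" by (rule sq3)
    also have "\<dots> = 3 * ((E k)\<^sup>2 + D\<^sup>2 * ((P k)\<^sup>2 + (M k)\<^sup>2))" by (simp add: power_mult_distrib algebra_simps)
    also have "(P k)\<^sup>2 = exp (- l * \<bar>of_int (k + - (2 * N))\<bar>)"
      by (simp add: P_def power2_eq_square flip: exp_add)
    also have "(M k)\<^sup>2 = exp (- l * \<bar>of_int (k + 2 * N)\<bar>)"
      by (simp add: M_def power2_eq_square flip: exp_add)
    finally show ?thesis .
  qed
  have 2: "(\<Sum>k\<in>K. (E k)\<^sup>2) \<le> \<epsilon>\<^sup>2 * (4 * of_int N + 1)"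
  proof -
    have "(\<Sum>k\<in>K. (E k)\<^sup>2) = (\<Sum>k\<in>K \<inter> {- (2 * N)..2 * N}. \<epsilon>\<^sup>2)"
      using K by (subst sum.inter_restrict) (auto simp: E_def intro!: sum.cong)
    also have "\<dots> \<le> (\<Sum>k\<in>{- (2 * N)..2 * N}. \<epsilon>\<^sup>2)" by (rule sum_mono2) auto
    also have "\<dots> = \<epsilon>\<^sup>2 * (4 * of_int N + 1)" using N by simp
    finally show ?thesis .
  qed
  have 3: "(\<Sum>k\<in>K. exp (- l * \<bar>real_of_int (k + i)\<bar>)) \<le> S" for i
    unfolding S_def infsum_exp_int_shift(2)[of l i, symmetric]
    by (rule finite_sum_le_infsum) (use K summable_exp_int[OF l] infsum_exp_int_shift(1)[of l i] in auto)
  have "(\<Sum>k\<in>K. (norm (\<Sum>j\<in>{-N..N}. alt_sign j * g (x + l * (of_int j - of_int k / 2))))\<^sup>2) \<le>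
     (\<Sum>k\<in>K. 3 * ((E k)\<^sup>2 + D\<^sup>2 * (exp (- l * \<bar>of_int (k + - (2 * N))\<bar>) + exp (- l * \<bar>of_int (k + 2 * N)\<bar>))))"
    by (rule sum_mono) (rule 1)
  also have "\<dots> = 3 * ((\<Sum>k\<in>K. (E k)\<^sup>2) + D\<^sup>2 * ((\<Sum>k\<in>K. exp (- l * \<bar>of_int (k + - (2 * N))\<bar>)) + (\<Sum>k\<in>K. exp (- l * \<bar>of_int (k + 2 * N)\<bar>))))"
    by (simp only: sum.distrib flip: sum_distrib_left)
  also have "\<dots> \<le> 3 * (\<epsilon>\<^sup>2 * (4 * of_int N + 1) + D\<^sup>2 * (S + S))"
    by (intro mult_left_mono add_mono 2 3) auto
  finally show ?thesis by (simp add: D_def algebra_simps)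
qed

section \<open>Failure of the lower frame bound\<close>

text \<open>The test function: its Zak transform is concentrated at \<open>\<gamma> = 1/2\<close> as \<open>N\<close> grows and near
\<open>x = c / l\<close> as \<open>d\<close> shrinks.\<close>

definition alt_comb :: "real \<Rightarrow> real \<Rightarrow> real \<Rightarrow> int \<Rightarrow> real \<Rightarrow> complex" where
  "alt_comb l c d N x = (\<Sum>j\<in>{-N..N}. alt_sign j * of_real (indicator {c - d + l * of_int j..c + d + l * of_int j} x))"

lemma norm_alt_comb:
  assumes "0 < d" "2 * d < l"
  shows "(norm (alt_comb l c d N x))\<^sup>2 = (\<Sum>j\<in>{-N..N}. indicator {c - d + l * of_int j..c + d + l * of_int j} x)"
proof (cases "\<exists>i\<in>{-N..N}. x \<in> {c - d + l * of_int i..c + d + l * of_int i}")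
  case True
  then obtain i where i: "i \<in> {-N..N}" "x \<in> {c - d + l * of_int i..c + d + l * of_int i}" by blast
  have z: "indicator {c - d + l * of_int j..c + d + l * of_int j} x = (if j = i then 1 else 0 :: real)" for j
  proof (cases "j = i")
    case False
    have "x \<notin> {c - d + l * of_int j..c + d + l * of_int j}"
    proof
      assume "x \<in> {c - d + l * of_int j..c + d + l * of_int j}"
      then have "l * \<bar>of_int j - of_int i\<bar> \<le> 2 * d"
        using i(2) assms by (auto simp: abs_if algebra_simps)
      moreover have "l * 1 \<le> l * \<bar>of_int j - of_int i\<bar>"
        using False assms by (intro mult_left_mono) linarith+
      ultimately show False using assms by linarith
    qed
    then show ?thesis using False by simp
  qed (use i in simp)
  have "alt_comb l c d N x = (\<Sum>j\<in>{-N..N}. if j = i then alt_sign i else 0)"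
    unfolding alt_comb_def z by (intro sum.cong) auto
  also have "\<dots> = alt_sign i" using i(1) by simp
  finally have "norm (alt_comb l c d N x) = 1" by simp
  moreover have "(\<Sum>j\<in>{-N..N}. indicator {c - d + l * of_int j..c + d + l * of_int j} x :: real) = 1"
    unfolding z using i(1) by simp
  ultimately show ?thesis by simp
next
  case False
  then have z: "indicator {c - d + l * of_int j..c + d + l * of_int j} x = (0 :: real)" if "j \<in> {-N..N}" for j
    using that by (auto simp: indicator_def)
  have "alt_comb l c d N x = 0" unfolding alt_comb_def using z by (intro sum.neutral) auto
  moreover have "(\<Sum>j\<in>{-N..N}. indicator {c - d + l * of_int j..c + d + l * of_int j} x :: real) = 0"
    using z by (intro sum.neutral) auto
  ultimately show ?thesis by simp
qed

lemma alt_comb_L2: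
  assumes "0 < d" "2 * d < l" "N \<ge> 0"
  shows "alt_comb l c d N \<in> L2" "(L2_norm (alt_comb l c d N))\<^sup>2 = (2 * of_int N + 1) * (2 * d)"
proof -
  have int: "integrable lborel (\<lambda>x. indicator {c - d + l * of_int j..c + d + l * of_int j} x :: real)" for j :: int
    by (rule integrable_real_indicator) (auto simp: emeasure_lborel_Icc_eq)
  have meas: "alt_comb l c d N \<in> borel_measurable lborel"
    unfolding alt_comb_def[abs_def] by measurable
  show "alt_comb l c d N \<in> L2"
    unfolding L2_def mem_Collect_eq norm_alt_comb[OF assms(1,2)]
    by (intro conjI meas Bochner_Integration.integrable_sum int)
  have "(LINT x|lborel. (norm (alt_comb l c d N x))\<^sup>2) = (\<Sum>j\<in>{-N..N}. 2 * d)"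
    unfolding norm_alt_comb[OF assms(1,2)] using assms int
    by (subst Bochner_Integration.integral_sum) (auto intro!: sum.cong)
  also have "\<dots> = (2 * of_int N + 1) * (2 * d)" using assms by simp
  finally show "(L2_norm (alt_comb l c d N))\<^sup>2 = (2 * of_int N + 1) * (2 * d)"
    unfolding L2_norm_def using assms by simp
qed

text \<open>A modulation by an integer multiple of \<open>1 / l\<close> does not see shifts by multiples of \<open>l\<close>; so all teeth of the comb
are folded onto one, and the inner products with fixed \<open>k\<close> become Fourier coefficients of
one truncated alternating sum.\<close>

lemma inner_alt_comb_gabor:
  fixes g :: "real \<Rightarrow> complex"
  assumes l: "l > 0" and cont: "continuous_on UNIV g"
  shows "L2_inner (alt_comb l c d N) (gabor_system g (l / 2) (1 / l) (k, m)) =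
    integral {c - d..c + d} (\<lambda>x. cnj (\<Sum>j\<in>{-N..N}. alt_sign j * g (x + l * (of_int j - of_int k / 2))) *
      cnj (cis (2 * pi * of_int m * x / l)))"
proof -
  define h where "h = (\<lambda>x. cnj (cis (2 * pi * of_int m * x / l) * g (x - l / 2 * of_int k)))"
  have ch: "continuous_on A h" for A
    unfolding h_def using l by (intro continuous_intros continuous_on_compose2[OF cont]) auto
  have gab: "cnj (gabor_system g (l / 2) (1 / l) (k, m) x) = h x" for x
    by (simp add: gabor_system_def h_def cis_conv_exp mult_ac)
  have si: "set_integrable lborel {c - d + l * of_int j..c + d + l * of_int j} h" for j :: int
    by (rule borel_integrable_atLeastAtMost'[OF ch])
  have "L2_inner (alt_comb l c d N) (gabor_system g (l / 2) (1 / l) (k, m)) =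
     (LINT x|lborel. (\<Sum>j\<in>{-N..N}. alt_sign j * (indicator {c - d + l * of_int j..c + d + l * of_int j} x *\<^sub>R h x)))"
    unfolding L2_inner_def gab alt_comb_def by (simp add: sum_distrib_right sum_distrib_left scaleR_conv_of_real mult_ac)
  also have "\<dots> = (\<Sum>j\<in>{-N..N}. alt_sign j * (LINT x:{c - d + l * of_int j..c + d + l * of_int j}|lborel. h x))"
    using si unfolding set_lebesgue_integral_def set_integrable_def
    by (subst Bochner_Integration.integral_sum) (auto simp del: mult_scaleR_right)
  also have "\<dots> = (\<Sum>j\<in>{-N..N}. alt_sign j * integral {c - d + l * of_int j..c + d + l * of_int j} h)"
    by (simp only: set_borel_integral_eq_integral(2)[OF si])
  also have "\<dots> = (\<Sum>j\<in>{-N..N}. alt_sign j * integral {c - d..c + d} (\<lambda>x. h (x + l * of_int j)))"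
    by (simp only: integral_shift_Icc_real[symmetric] o_def add.commute[of "l * _"])
  also have "\<dots> = integral {c - d..c + d} (\<lambda>x. \<Sum>j\<in>{-N..N}. alt_sign j * h (x + l * of_int j))"
  proof -
    have "(\<lambda>x. alt_sign j * h (x + l * of_int j)) integrable_on {c - d..c + d}" for j
      by (intro integrable_continuous_real continuous_intros continuous_on_compose2[OF ch[of UNIV]]) auto
    then show ?thesis by (subst Henstock_Kurzweil_Integration.integral_sum) auto
  qed
  also have "(\<lambda>x. \<Sum>j\<in>{-N..N}. alt_sign j * h (x + l * of_int j)) = 
     (\<lambda>x. cnj (\<Sum>j\<in>{-N..N}. alt_sign j * g (x + l * (of_int j - of_int k / 2))) * cnj (cis (2 * pi * of_int m * x / l)))"
  proof
    fix x
    have "h (x + l * of_int j) = cnj (g (x + l * (of_int j - of_int k / 2))) * cnj (cis (2 * pi * of_int m * x / l))" for j :: int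
    proof -
      have "2 * pi * of_int m * (x + l * of_int j) / l = 2 * pi * of_int m * x / l + 2 * pi * of_int (m * j)"
        using l by (simp add: field_simps)
      moreover have "cis (2 * pi * of_int (m * j)) = 1" by (rule cis_multiple_2pi) auto
      ultimately have 1: "cis (2 * pi * of_int m * (x + l * of_int j) / l) = cis (2 * pi * of_int m * x / l)"
        by (simp flip: cis_mult)
      have 2: "x + l * of_int j - l / 2 * of_int k = x + l * (of_int j - of_int k / 2)"
        by (simp add: algebra_simps)
      show ?thesis unfolding h_def 1 2 complex_cnj_mult by (rule mult.commute)
    qed
    moreover have "cnj (alt_sign j) = alt_sign j" for j by (simp add: alt_sign_def)
    ultimately show "(\<Sum>j\<in>{-N..N}. alt_sign j * h (x + l * of_int j)) = 
       cnj (\<Sum>j\<in>{-N..N}. alt_sign j * g (x + l * (of_int j - of_int k / 2))) * cnj (cis (2 * pi * of_int m * x / l))"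
      by (simp add: sum_distrib_right sum_distrib_left mult_ac)
  qed
  finally show ?thesis .
qed

text \<open>Translations by even and odd multiples of \<open>l / 2\<close> see the alternating sums at \<open>c\<close> and
\<open>c - l / 2\<close>; both vanish, so near \<open>c\<close> all of them are at most \<open>\<epsilon>\<close>. The total energy of the
inner products with \<open>alt_comb\<close> is then of order \<open>\<epsilon>\<^sup>2 N\<close> plus a bounded boundary contribution,
against a squared norm of order \<open>N\<close>.\<close>

lemma not_frame_of_altsum_zero:
  fixes g :: "real \<Rightarrow> complex"
  assumes l: "l > 0" and cont: "continuous_on UNIV g" 
    and g: "\<And>y. norm (g y) \<le> C * exp (- \<bar>y\<bar>)" and C: "C > 0"
    and zero: "altsum l g c = 0" "altsum l g (c - l / 2) = 0"
  shows "(l / 2, 1 / l) \<notin> frame_set g"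
proof
  assume "(l / 2, 1 / l) \<in> frame_set g"
  then obtain A where A: "A > 0" and frame: "\<And>f. f \<in> L2 \<Longrightarrow> 
      (\<lambda>i. (norm (L2_inner f (gabor_system g (l / 2) (1 / l) i)))\<^sup>2) summable_on UNIV \<and>
      A * (L2_norm f)\<^sup>2 \<le> (\<Sum>\<^sub>\<infinity>i. (norm (L2_inner f (gabor_system g (l / 2) (1 / l) i)))\<^sup>2)"
    unfolding frame_set_def is_L2_frame_def by blast
  define R where "R = \<bar>c\<bar> + 2 * l"
  define S where "S = (\<Sum>\<^sub>\<infinity>i::int. exp (- l * \<bar>of_int i\<bar>) :: real)"
  \<comment> \<open>chosen so that \<open>3 l \<epsilon>\<^sup>2 (4 N + 1)\<close> is about half of \<open>A (2 N + 1)\<close>\<close>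
  define \<epsilon> where "\<epsilon> = sqrt (A / (12 * l))"
  have \<epsilon>: "\<epsilon> > 0" "\<epsilon>\<^sup>2 = A / (12 * l)" using A l by (auto simp: \<epsilon>_def)
  have contW: "continuous_on {-R..R} (altsum l g)"
    by (rule continuous_on_altsum[OF cont g C l])
  have cR: "c \<in> {-R..R}" "c - l / 2 \<in> {-R..R}"
    using l abs_ge_self[of c] abs_ge_minus_self[of c] by (auto simp: R_def)
  have "\<exists>d>0. \<forall>x\<in>{-R..R}. dist x c < d \<longrightarrow> dist (altsum l g x) (altsum l g c) < \<epsilon>"
    using contW[unfolded continuous_on_iff, rule_format, OF _ \<epsilon>(1), of c] cR by blast
  then obtain d1 where d1: "d1 > 0" "\<And>x. x \<in> {-R..R} \<Longrightarrow> \<bar>x - c\<bar> < d1 \<Longrightarrow> norm (altsum l g x) < \<epsilon>"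
    using zero(1) by (auto simp: dist_norm)
  have "\<exists>d>0. \<forall>x\<in>{-R..R}. dist x (c - l / 2) < d \<longrightarrow> dist (altsum l g x) (altsum l g (c - l / 2)) < \<epsilon>"
    using contW[unfolded continuous_on_iff, rule_format, OF _ \<epsilon>(1), of "c - l / 2"] cR by blast
  then obtain d2 where d2: "d2 > 0" "\<And>x. x \<in> {-R..R} \<Longrightarrow> \<bar>x - (c - l / 2)\<bar> < d2 \<Longrightarrow> norm (altsum l g x) < \<epsilon>"
    using zero(2) by (auto simp: dist_norm)
  define d where "d = min (l / 4) (min d1 d2 / 2)"
  have d: "0 < d" "d < d1" "d < d2" "2 * d < l" using l d1(1) d2(1) by (auto simp: d_def min_def)
  have W: "norm (altsum l g (x - l * of_int k / 2)) \<le> \<epsilon>" if x: "x \<in> {c - d..c + d}" for x and k :: int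
  proof (cases "even k")
    case True
    then obtain i where k: "k = 2 * i" by blast
    have "norm (altsum l g (x - l * of_int k / 2)) = norm (altsum l g x)"
      using altsum_shift[of l g "x - l * of_int k / 2" i] by (simp add: k)
    also have "\<dots> \<le> \<epsilon>" 
      using x d l by (intro less_imp_le[OF d1(2)]) (auto simp: R_def abs_if)
    finally show ?thesis .
  next
    case False
    then obtain i where k: "k = 2 * i + 1" using oddE by blast
    have "x - l / 2 = x - l * of_int k / 2 + l * of_int i" by (simp add: k algebra_simps add_divide_distrib)
    then have "norm (altsum l g (x - l * of_int k / 2)) = norm (altsum l g (x - l / 2))"
      using altsum_shift[of l g "x - l * of_int k / 2" i] by (simp only:)
    also have "\<dots> \<le> \<epsilon>" 
      using x d l by (intro less_imp_le[OF d2(2)]) (auto simp: R_def abs_if)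
    finally show ?thesis .
  qed
  have xR: "\<bar>x\<bar> \<le> R" if "x \<in> {c - d..c + d}" for x
    using that d l by (auto simp: R_def abs_if)
  define H where "H = 6 * (C * exp R * S)\<^sup>2 * S"
  have upper: "(\<Sum>\<^sub>\<infinity>i. (norm (L2_inner (alt_comb l c d N) (gabor_system g (l / 2) (1 / l) i)))\<^sup>2) \<le> 
      l * (2 * d) * (3 * (\<epsilon>\<^sup>2 * (4 * of_int N + 1)) + H)" if N: "N \<ge> 0" for N
  proof (rule infsum_le_finite_sums)
    show "(\<lambda>i. (norm (L2_inner (alt_comb l c d N) (gabor_system g (l / 2) (1 / l) i)))\<^sup>2) summable_on UNIV"
      using frame alt_comb_L2(1)[OF d(1,4) N] by blast
    fix F :: "(int \<times> int) set" assume F: "finite F" "F \<subseteq> UNIV"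
    define a where "a = (\<lambda>k x. \<Sum>j\<in>{-N..N}. alt_sign j * g (x + l * (of_int j - of_int k / 2)))"
    have ca: "continuous_on B (a k)" for B and k :: int
      unfolding a_def by (intro continuous_intros continuous_on_compose2[OF cont]) auto
    have ia: "(\<lambda>x. (norm (a k x))\<^sup>2) integrable_on {c - d..c + d}" for k :: int
      by (intro integrable_continuous_real continuous_intros ca)
    have fin: "finite (fst ` F)" "finite (snd ` F)" using F by auto
    have "(\<Sum>i\<in>F. (norm (L2_inner (alt_comb l c d N) (gabor_system g (l / 2) (1 / l) i)))\<^sup>2) \<le>
        (\<Sum>i\<in>fst ` F \<times> snd ` F. (norm (L2_inner (alt_comb l c d N) (gabor_system g (l / 2) (1 / l) i)))\<^sup>2)"
      using fin by (intro sum_mono2) (auto intro: rev_image_eqI)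
    also have "\<dots> = (\<Sum>k\<in>fst ` F. \<Sum>m\<in>snd ` F. (norm (L2_inner (alt_comb l c d N) (gabor_system g (l / 2) (1 / l) (k, m))))\<^sup>2)"
      by (simp add: sum.cartesian_product case_prod_unfold)
    also have "\<dots> \<le> (\<Sum>k\<in>fst ` F. l * integral {c - d..c + d} (\<lambda>x. (norm (a k x))\<^sup>2))"
    proof (rule sum_mono)
      fix k
      have "(\<Sum>m\<in>snd ` F. (norm (integral {c - d..c + d} (\<lambda>x. cnj (a k x) * cnj (cis (2 * pi * of_int m * x / l)))))\<^sup>2)
        \<le> l * integral {c - d..c + d} (\<lambda>x. (norm (cnj (a k x)))\<^sup>2)"
        by (rule bessel_inequality[OF l _ _ fin(2)]) (use d in \<open>auto intro!: continuous_intros ca\<close>)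
      then show "(\<Sum>m\<in>snd ` F. (norm (L2_inner (alt_comb l c d N) (gabor_system g (l / 2) (1 / l) (k, m))))\<^sup>2)
        \<le> l * integral {c - d..c + d} (\<lambda>x. (norm (a k x))\<^sup>2)"
        unfolding inner_alt_comb_gabor[OF l cont] complex_mod_cnj a_def .
    qed
    also have "\<dots> = l * integral {c - d..c + d} (\<lambda>x. \<Sum>k\<in>fst ` F. (norm (a k x))\<^sup>2)"
      using fin ia by (simp add: Henstock_Kurzweil_Integration.integral_sum sum_distrib_left)
    also have "\<dots> \<le> l * integral {c - d..c + d} (\<lambda>x. 3 * (\<epsilon>\<^sup>2 * (4 * of_int N + 1)) + H)"
    proof (intro mult_left_mono integral_le)
      show "(\<lambda>x. \<Sum>k\<in>fst ` F. (norm (a k x))\<^sup>2) integrable_on {c - d..c + d}"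
        using fin ia by (intro integrable_sum)
      fix x assume x: "x \<in> {c - d..c + d}"
      show "(\<Sum>k\<in>fst ` F. (norm (a k x))\<^sup>2) \<le> 3 * (\<epsilon>\<^sup>2 * (4 * of_int N + 1)) + H"
        using sum_truncated_altsum_bound[OF g C l xR[OF x] N fin(1) W[OF x]]
        by (simp add: a_def H_def S_def)
    qed (use l in auto)
    also have "\<dots> = l * (2 * d) * (3 * (\<epsilon>\<^sup>2 * (4 * of_int N + 1)) + H)"
      using d by simp
    finally show "(\<Sum>i\<in>F. (norm (L2_inner (alt_comb l c d N) (gabor_system g (l / 2) (1 / l) i)))\<^sup>2) \<le>
       l * (2 * d) * (3 * (\<epsilon>\<^sup>2 * (4 * of_int N + 1)) + H)" .
  qed
  have bound: "A * of_int N \<le> 2 * l * H" if N: "N \<ge> 1" for N :: int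
  proof -
    have N0: "N \<ge> 0" using N by simp
    have "A * ((2 * of_int N + 1) * (2 * d)) \<le> l * (2 * d) * (3 * (\<epsilon>\<^sup>2 * (4 * of_int N + 1)) + H)"
      using frame[OF alt_comb_L2(1)[OF d(1,4) N0, of c]] upper[OF N0] 
      unfolding alt_comb_L2(2)[OF d(1,4) N0] by linarith
    then have "(A * (2 * of_int N + 1)) * (2 * d) \<le> (l * (3 * (\<epsilon>\<^sup>2 * (4 * of_int N + 1)) + H)) * (2 * d)"
      by (simp only: mult_ac)
    then have "A * (2 * of_int N + 1) \<le> l * (3 * (\<epsilon>\<^sup>2 * (4 * of_int N + 1)) + H)"
      using d by simp
    also have "\<dots> = A * (4 * of_int N + 1) / 4 + l * H"
      unfolding \<epsilon>(2) using l by (simp add: field_simps)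
    finally have "A * (2 * of_int N + 1) \<le> A * (4 * of_int N + 1) / 4 + l * H" .
    moreover have "A * (2 * of_int N + 1) = 2 * (A * of_int N) + A" 
      "A * (4 * of_int N + 1) / 4 = A * of_int N + A / 4" by (simp_all add: algebra_simps add_divide_distrib)
    moreover have "A * of_int N \<ge> 0" using A N by simp
    moreover have "H \<ge> 0" unfolding H_def S_def by (intro mult_nonneg_nonneg infsum_nonneg) auto
    then have "l * H \<ge> 0" using l by simp
    ultimately show ?thesis using A by linarith
  qed
  obtain N :: nat where N: "real N > 2 * l * H / A" using reals_Archimedean2 by blast
  have "2 * l * H < A * real N" using N A by (simp add: field_simps)
  also have "\<dots> \<le> A * of_int (int N + 1)" using A by (intro mult_left_mono) auto
  also have "\<dots> \<le> 2 * l * H" by (rule bound) simp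
  finally show False by simp
qed

section \<open>Zak transform of Hermite functions\<close>

lemma has_sum_int_decode:
  assumes "(\<lambda>m. f (int_decode m)) sums s" "summable (\<lambda>m. norm (f (int_decode m)))"
  shows "(f has_sum (s :: 'a :: banach)) UNIV"
proof -
  have "((\<lambda>m. f (int_decode m)) has_sum s) UNIV"
    using assms by (intro norm_summable_imp_has_sum)
  then show ?thesis
    using has_sum_reindex_bij_betw[of int_decode UNIV UNIV f s] bij_int_decode by simp
qed

text \<open>The enumeration \<open>0, -1, 1, -2, 2, ...\<close> of the integers runs through the points \<open>k + 1/4\<close> by
increasing absolute value \<open>(2 m + 1) / 4\<close>.\<close>

lemma theta_int_decode:
  assumes "even n"
  shows "alt_sign (int_decode m) * of_real (psi n (l * (1 / 4 + of_int (int_decode m)))) =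
     complex_of_real (chi m * psi n (l * (2 * real m + 1) / 4))"
proof (cases "even m")
  case True
  then obtain k where m: "m = 2 * k" by blast
  have "int_decode m = int k" by (simp add: m int_decode_def sum_decode_def)
  moreover have "Suc m div 2 = k" by (simp add: m)
  moreover have "l * (1 / 4 + of_int (int k)) = l * (2 * real m + 1) / 4" by (simp add: m field_simps)
  ultimately show ?thesis unfolding chi_def by (simp only:) (simp add: alt_sign_def)
next
  case False
  then obtain k where m: "m = 2 * k + 1" using oddE by blast
  have "int_decode m = - int k - 1" by (simp add: m int_decode_def sum_decode_def)
  moreover have "Suc m div 2 = Suc k" by (simp add: m)
  moreover have "l * (1 / 4 + real_of_int (- int k - 1)) = - (l * (2 * real m + 1) / 4)" by (simp add: m field_simps)
  ultimately show ?thesis using psi_even[OF assms] by (simp add: alt_sign_def chi_def)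
qed

lemma theta_has_sum:
  assumes "even n" "l > 0"
  shows "((\<lambda>k. alt_sign k * of_real (psi n (l * (1 / 4 + of_int k)))) has_sum complex_of_real (theta n l)) UNIV"
proof (rule has_sum_int_decode)
  show "(\<lambda>m. alt_sign (int_decode m) * of_real (psi n (l * (1 / 4 + of_int (int_decode m))))) sums complex_of_real (theta n l)"
    unfolding theta_int_decode[OF assms(1)] theta_def
    by (intro sums_of_real summable_sums summable_theta assms)
  obtain C where C: "C > 0" "\<And>x. \<bar>psi n x\<bar> \<le> C * exp (- \<bar>x\<bar>)"
    using psi_bound by blast
  show "summable (\<lambda>m. norm (alt_sign (int_decode m) * complex_of_real (psi n (l * (1 / 4 + of_int (int_decode m))))))"
    unfolding theta_int_decode[OF assms(1)] norm_of_real
    by (rule summable_comparison_test'[where N = 0, OF summable_exp_power[OF assms(2), of C]])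
       (use psi_term_bound[OF assms(2) order_refl C(2,1)] in simp)
qed

lemma altsum_hermite:
  assumes "even n" "l > 0"
  shows "altsum l (hermite_fun n) (l / 4) = of_real (hermite_const n powr (- 1 / 2) * theta n l)"
proof -
  have "altsum l (hermite_fun n) (l / 4) =
     (\<Sum>\<^sub>\<infinity>k. of_real (hermite_const n powr (- 1 / 2)) * (alt_sign k * of_real (psi n (l * (1 / 4 + of_int k)))))"
    unfolding altsum_def hermite_fun_eq_psi
    by (rule infsum_cong) (simp add: algebra_simps)
  also have "\<dots> = of_real (hermite_const n powr (- 1 / 2)) * of_real (theta n l)"
    by (intro infsumI has_sum_cmult_right theta_has_sum assms)
  finally show ?thesis by simp
qed

lemma zak_eq_altsum: "zak l f x (1 / 2) = of_real (sqrt l) * altsum l f (l * x)"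
proof -
  have "exp (- 2 * complex_of_real pi * \<i> * of_int k * complex_of_real (1 / 2)) = alt_sign k" for k
  proof -
    have "exp (- 2 * complex_of_real pi * \<i> * of_int k * complex_of_real (1 / 2)) = cis (- (pi * of_int k))"
      by (simp add: cis_conv_exp mult_ac)
    also have "\<dots> = alt_sign k" by (simp add: complex_eq_iff alt_sign_def)
    finally show ?thesis .
  qed
  then show ?thesis
    unfolding zak_def altsum_def by (simp add: distrib_left mult.commute[of "alt_sign _"])
qed

lemma altsum_minus:
  assumes "\<And>x. f (- x) = f x"
  shows "altsum l f (- y) = altsum l f y"
proof -
  have "altsum l f (- y) = (\<Sum>\<^sub>\<infinity>k. alt_sign (- k) * f (- y + l * of_int (- k)))"
    unfolding altsum_def
    by (rule infsum_reindex_bij_betw[symmetric]) (rule bij_betw_byWitness[where f' = uminus], auto)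
  also have "\<dots> = altsum l f y"
    unfolding altsum_def
  proof (rule infsum_cong)
    fix k
    have "f (- y + l * of_int (- k)) = f (y + l * of_int k)" using assms[of "y + l * of_int k"] by simp
    then show "alt_sign (- k) * f (- y + l * of_int (- k)) = alt_sign k * f (y + l * of_int k)" 
      by (simp add: alt_sign_def)
  qed
  finally show ?thesis .
qed

text \<open>Evenness makes one zero serve twice: the two points needed are \<open>l / 4\<close> and \<open>l / 4 - l / 2 = - l / 4\<close>.\<close>

lemma not_frame_of_theta_zero:
  assumes "even n" "l > 0" "theta n l = 0"
  shows "(l / 2, 1 / l) \<notin> frame_set (hermite_fun n)"
proof -
  obtain C where C: "C > 0" "\<And>x. \<bar>psi n x\<bar> \<le> C * exp (- \<bar>x\<bar>)"
    using psi_bound by blast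
  define c where "c = hermite_const n powr (- 1 / 2)"
  have c: "c > 0" using hermite_const_pos[of n] by (simp add: c_def)
  have h: "hermite_fun n x = of_real (c * psi n x)" for x
    by (simp add: hermite_fun_eq_psi c_def)
  have even: "hermite_fun n (- x) = hermite_fun n x" for x
    using psi_even[OF assms(1)] by (simp add: h)
  have z: "altsum l (hermite_fun n) (l / 4) = 0" using altsum_hermite[OF assms(1,2)] assms(3) by simp
  show ?thesis
  proof (rule not_frame_of_altsum_zero[OF assms(2), where c = "l / 4" and C = "c * C"])
    show "continuous_on UNIV (hermite_fun n)"
      unfolding h[abs_def] by (intro continuous_intros)
    show "norm (hermite_fun n y) \<le> c * C * exp (- \<bar>y\<bar>)" for y
      using mult_left_mono[OF C(2)[of y], of c] c by (simp add: h norm_mult abs_mult mult.assoc)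
    show "altsum l (hermite_fun n) (l / 4 - l / 2) = 0"
    proof -
      have "l / 4 - l / 2 = - (l / 4)" by simp
      then show ?thesis using z altsum_minus[of "hermite_fun n", OF even] by metis
    qed
  qed (use z c C in auto)
qed

theorem mainTheorem2:
  fixes n :: nat
  assumes "n \<ge> 4" and "even n"
  shows "\<exists>l\<^sub>1 > sqrt 2.
           zak l\<^sub>1 (hermite_fun n) (1 / 4) (1 / 2) = 0 \<and>
           (l\<^sub>1 / 2, 1 / l\<^sub>1) \<notin> frame_set (hermite_fun n) \<and>
           (1 / l\<^sub>1, l\<^sub>1 / 2) \<notin> frame_set (hermite_fun n)"
proof -
  obtain l where l: "l > sqrt 2" "theta n l = 0" using ex_theta_zero[OF assms(1)] .
  have l0: "l > 0" using l(1) real_sqrt_gt_zero[of 2] by linarith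
  have "theta n (2 / l) = 0"
    using theta_functional[OF assms(2) theta0_functional l0] l(2) by simp
  then have "(2 / l / 2, 1 / (2 / l)) \<notin> frame_set (hermite_fun n)"
    by (rule not_frame_of_theta_zero[OF assms(2), rotated]) (use l0 in simp)
  then have "(1 / l, l / 2) \<notin> frame_set (hermite_fun n)" by simp
  moreover have "zak l (hermite_fun n) (1 / 4) (1 / 2) = 0"
    using altsum_hermite[OF assms(2) l0] l(2) by (simp add: zak_eq_altsum)
  ultimately show ?thesis
    using l(1) not_frame_of_theta_zero[OF assms(2) l0 l(2)] by blast
qed

end
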